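(* Let $k\ge 2$ be a constant and let $\Phi$ be a random $k$-SAT formula on $n$ variables with $m=\Theta(n)$ clauses whose variable distribution is given by weights following a power law with exponent $\beta$. If $\beta\ge\frac{2k-1}{k-1}+\varepsilon$ for an arbitrary constant $\varepsilon>0$, then $\Phi$ is satisfiable with high probability provided $\tfrac mn$ is a small enough constant.
   Context: Random $k$-SAT model: given $n$ Boolean variables, $m$ clauses and a probability distribution $\vec p$ on $\{1,\dots,n\}$, the formula is the conjunction of $m$ independently sampled clauses; each clause is sampled by selecting $k$ variables independently from $\vec p$, repeating until no two coincide, and negating each independently with probability $1/2$. The distribution is given by weights $w_1\le\dots\le w_n$ via $p_i=w_i/\sum_j w_j$. The weights follow a power law with exponent $\beta$ if $w_1=\Theta(1)$, $w_n=\Theta(n^{1/(\beta-1)})$, and for all $w\in[w_1,w_n]$ the fraction of indices $i$ with $w_i\ge w$ is $\Theta(w^{1-\beta})$. Asymptotics as $n\to\infty$; "with high probability" means with probability $1-O(n^{-\delta})$ for some $\delta>0$. *)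

theory Defs
  imports "HOL-Probability.Probability" "HOL-Library.Landau_Symbols"
begin

text \<open>
  Variables are natural numbers, a formula on \<open>n\<close> variables uses \<open>1, \<dots>, n\<close>. The literal
  \<open>(v, True)\<close> is the variable \<open>v\<close>, the literal \<open>(v, False)\<close> is its negation.
\<close>

type_synonym literal = "nat \<times> bool"
type_synonym clause = "literal list"
type_synonym formula = "clause list"

definition satisfies :: "(nat \<Rightarrow> bool) \<Rightarrow> formula \<Rightarrow> bool" where
  "satisfies a \<Phi> \<longleftrightarrow> (\<forall>C\<in>set \<Phi>. \<exists>(v, b)\<in>set C. a v = b)"

definition satisfiable :: "formula \<Rightarrow> bool" where
  "satisfiable \<Phi> \<longleftrightarrow> (\<exists>a. satisfies a \<Phi>)"

text \<open>
  Drawing \<open>k\<close> independent variables until no two coincide yields the product distribution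
  conditioned on distinctness; see \<open>clause_vars_pmf_repeat\<close> and \<open>clause_vars_pmf_unique\<close> below.
  If the support of \<open>p\<close> has fewer than \<open>k\<close> elements, the repetition never ends and
  \<open>clause_vars_pmf k p\<close> is an unspecified distribution.
\<close>

definition clause_vars_pmf :: "nat \<Rightarrow> nat pmf \<Rightarrow> nat list pmf" where
  "clause_vars_pmf k p = cond_pmf (replicate_pmf k p) {vs. distinct vs}"

definition clause_pmf :: "nat \<Rightarrow> nat pmf \<Rightarrow> clause pmf" where
  "clause_pmf k p =
     do {vs \<leftarrow> clause_vars_pmf k p;
         bs \<leftarrow> replicate_pmf k (bernoulli_pmf (1/2));
         return_pmf (zip vs bs)}"

definition ksat_pmf :: "nat \<Rightarrow> nat \<Rightarrow> nat pmf \<Rightarrow> formula pmf" where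
  "ksat_pmf k m p = replicate_pmf m (clause_pmf k p)"

definition weights :: "nat \<Rightarrow> (nat \<Rightarrow> real) \<Rightarrow> bool" where
  "weights n w \<longleftrightarrow> (\<forall>i\<in>{1..n}. 0 < w i) \<and> (\<forall>i\<in>{1..n}. \<forall>j\<in>{1..n}. i \<le> j \<longrightarrow> w i \<le> w j)"

definition weight_pmf :: "nat \<Rightarrow> (nat \<Rightarrow> real) \<Rightarrow> nat pmf" where
  "weight_pmf n w = embed_pmf (\<lambda>i. if i \<in> {1..n} then w i / (\<Sum>j=1..n. w j) else 0)"

text \<open>
  \<open>w n i\<close> is the \<open>i\<close>-th weight for \<open>n\<close> variables. In the last conjunct the constants hidden in
  the \<open>\<Theta>\<close> are uniform in \<open>n\<close> and in the threshold \<open>x\<close>.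
\<close>

definition power_law_weights :: "real \<Rightarrow> (nat \<Rightarrow> nat \<Rightarrow> real) \<Rightarrow> bool" where
  "power_law_weights \<beta> w \<longleftrightarrow>
     (\<forall>n. weights n (w n)) \<and>
     (\<lambda>n. w n 1) \<in> \<Theta>(\<lambda>n. 1) \<and>
     (\<lambda>n. w n n) \<in> \<Theta>(\<lambda>n. real n powr (1 / (\<beta> - 1))) \<and>
     (\<exists>c>0. \<exists>C>0. \<forall>\<^sub>F n in sequentially. \<forall>x\<in>{w n 1..w n n}.
        c * x powr (1 - \<beta>) \<le> real (card {i\<in>{1..n}. x \<le> w n i}) / real n \<and>
        real (card {i\<in>{1..n}. x \<le> w n i}) / real n \<le> C * x powr (1 - \<beta>))"

definition with_high_probability :: "(nat \<Rightarrow> real) \<Rightarrow> bool" where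
  "with_high_probability P \<longleftrightarrow> (\<exists>\<delta>>0. (\<lambda>n. 1 - P n) \<in> O(\<lambda>n. real n powr (- \<delta>)))"

lemma pmf_weight_pmf:
  assumes "weights n w" "n \<ge> 1"
  shows "pmf (weight_pmf n w) i = (if i \<in> {1..n} then w i / (\<Sum>j=1..n. w j) else 0)"
proof -
  define f where "f = (\<lambda>i. if i \<in> {1..n} then w i / (\<Sum>j=1..n. w j) else 0)"
  have pos: "0 < (\<Sum>j=1..n. w j)"
    using assms by (intro sum_pos) (auto simp: weights_def)
  have nonneg: "0 \<le> f i" for i
    using assms pos by (auto simp: f_def weights_def intro!: divide_nonneg_pos less_imp_le)
  have "(\<integral>\<^sup>+i. ennreal (f i) \<partial>count_space UNIV) = (\<Sum>i\<in>{1..n}. ennreal (f i))"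
    by (rule nn_integral_count_space') (auto simp: f_def)
  also have "\<dots> = ennreal (\<Sum>i\<in>{1..n}. f i)"
    using nonneg by (intro sum_ennreal) auto
  also have "(\<Sum>i\<in>{1..n}. f i) = (\<Sum>i\<in>{1..n}. w i / (\<Sum>j=1..n. w j))"
    by (intro sum.cong) (auto simp: f_def)
  also have "\<dots> = 1"
    using pos by (simp add: sum_divide_distrib[symmetric])
  finally have "pmf (embed_pmf f) i = f i"
    using nonneg by (intro pmf_embed_pmf) auto
  then show ?thesis
    by (simp add: weight_pmf_def f_def)
qed

lemma clause_vars_repeat_iff:
  assumes "set_pmf (replicate_pmf k p) \<inter> {vs. distinct vs} \<noteq> {}"
  shows "q = bind_pmf (replicate_pmf k p) (\<lambda>vs. if distinct vs then return_pmf vs else q) \<longleftrightarrow>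
         q = clause_vars_pmf k p"
proof -
  let ?D = "replicate_pmf k p"
  let ?S = "{vs :: nat list. distinct vs}"
  have pos: "measure ?D ?S > 0"
    using assms by (simp add: measure_measure_pmf_not_zero order_less_le)
  have step: "pmf (bind_pmf ?D (\<lambda>vs. if distinct vs then return_pmf vs else q)) x
      = (if distinct x then pmf ?D x else 0) + pmf q x * (1 - measure ?D ?S)" for x
  proof -
    have "pmf (bind_pmf ?D (\<lambda>vs. if distinct vs then return_pmf vs else q)) x
        = (\<integral>vs. indicator ({x} \<inter> ?S) vs + pmf q x * indicator (- ?S) vs \<partial>?D)"
      unfolding pmf_bind by (intro Bochner_Integration.integral_cong) (auto simp: indicator_def)
    also have "\<dots> = measure ?D ({x} \<inter> ?S) + pmf q x * measure ?D (- ?S)"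
      by (subst Bochner_Integration.integral_add) (auto simp: measure_pmf.emeasure_eq_measure)
    also have "measure ?D (- ?S) = 1 - measure ?D ?S"
      using measure_pmf.prob_compl[of ?S ?D] by (simp add: Compl_eq_Diff_UNIV)
    also have "measure ?D ({x} \<inter> ?S) = (if distinct x then pmf ?D x else 0)"
      by (auto simp: pmf.rep_eq)
    finally show ?thesis .
  qed
  have "q = bind_pmf ?D (\<lambda>vs. if distinct vs then return_pmf vs else q) \<longleftrightarrow>
        (\<forall>x. pmf q x = (if distinct x then pmf ?D x else 0) + pmf q x * (1 - measure ?D ?S))"
    unfolding pmf_eq_iff step ..
  also have "\<dots> \<longleftrightarrow> (\<forall>x. pmf q x = (if distinct x then pmf ?D x / measure ?D ?S else 0))"
    using pos by (intro all_cong1) (auto simp: field_simps)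
  also have "\<dots> \<longleftrightarrow> q = clause_vars_pmf k p"
    unfolding pmf_eq_iff clause_vars_pmf_def pmf_cond[OF assms] by simp
  finally show ?thesis .
qed

lemmas clause_vars_pmf_repeat = clause_vars_repeat_iff[THEN iffD2, OF _ refl]
lemmas clause_vars_pmf_unique = clause_vars_repeat_iff[THEN iffD1]

end

theory Submission
  imports Defs "HOL-Real_Asymp.Real_Asymp"
begin

text \<open>
  Keep from every clause only its two lightest variables; this gives a random multigraph with one
  edge per clause. If each edge can be assigned one of its endpoints injectively, the assigned
  variables can be set so as to satisfy all clauses. Such an assignment fails to exist only if
  some trail of distinct edges returns to an inner vertex at both of its ends (a ``bicycle'').
  The probability that a clause yields the edge \<open>{a, b}\<close> is at most \<open>K r\<^sub>a r\<^sub>b\<close>, where \<open>r\<close> is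
  a weight that takes into account that the other \<open>k - 2\<close> variables are heavier than \<open>a\<close> and \<open>b\<close>.
  The hypothesis on \<open>\<beta>\<close> guarantees that \<open>\<Sum> r\<^sub>x\<^sup>2 = O(1 / n)\<close> and that \<open>max r\<^sub>x\<close> is
  polynomially smaller than \<open>1 / sqrt n\<close>. The expected number of bicycles with \<open>L\<close> inner vertices is
  then at most \<open>O(m (max r)\<^sup>2)\<close> times \<open>L\<^sup>2 (m K \<Sum> r\<^sub>x\<^sup>2)\<^sup>L\<close> up to constants, which is summable for
  small \<open>m / n\<close>.
\<close>

subsection \<open>Trails and injective choices of endpoints\<close>

text \<open>Repeated edges are allowed here; distinctness is demanded separately where it matters.
  The multigraph enters only through the relation \<open>link\<close>, so the same notion serves
  both for a fixed edge assignment and for random events indexed by pairs of vertices.\<close>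

fun trail :: "('e \<Rightarrow> 'v \<Rightarrow> 'v \<Rightarrow> bool) \<Rightarrow> 'v list \<Rightarrow> 'e list \<Rightarrow> bool" where
  "trail link [x] [] \<longleftrightarrow> True"
| "trail link (x # y # vs) (e # es) \<longleftrightarrow> link e x y \<and> trail link (y # vs) es"
| "trail link _ _ \<longleftrightarrow> False"

lemma trail_length: "trail link vs es \<Longrightarrow> length vs = Suc (length es)"
  by (induction link vs es rule: trail.induct) auto

lemma trail_nth:
  "trail link vs es \<Longrightarrow> t < length es \<Longrightarrow> link (es ! t) (vs ! t) (vs ! Suc t)"
  by (induction link vs es arbitrary: t rule: trail.induct)
    (auto simp: less_Suc_eq_0_disj)

lemma trail_snoc:
  assumes "trail link (vs @ [x]) es" and "link e x y"
  shows "trail link (vs @ [x, y]) (es @ [e])"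
  using assms
proof (induction vs arbitrary: es)
  case Nil
  then show ?case by (cases es) auto
next
  case (Cons v vs)
  then show ?case by (cases es; cases vs) auto
qed

lemma trail_rev:
  assumes "trail link vs es" and "\<And>e x y. link e x y \<Longrightarrow> link e y x"
  shows "trail link (rev vs) (rev es)"
  using assms by (induction link vs es rule: trail.induct) (auto intro!: trail_snoc)

lemma trail_mono:
  assumes "trail link vs es" and "\<And>e x y. e \<in> set es \<Longrightarrow> link e x y \<Longrightarrow> link' e x y"
  shows "trail link' vs es"
  using assms by (induction link vs es rule: trail.induct) auto

lemma trail_set:
  assumes "\<And>e x y. e \<in> set es \<Longrightarrow> link e x y \<Longrightarrow> x \<in> U \<and> y \<in> U"
    and "trail link vs es" and "es \<noteq> []"
  shows "set vs \<subseteq> U"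
proof
  fix x assume "x \<in> set vs"
  then obtain t where t: "t < length vs" "x = vs ! t"
    by (auto simp: in_set_conv_nth)
  have len: "length vs = Suc (length es)"
    using assms(2) by (rule trail_length)
  show "x \<in> U"
  proof (cases "t < length es")
    case True
    then show ?thesis using trail_nth[OF assms(2) True] assms(1) t by (metis nth_mem)
  next
    case False
    then have "t = Suc (length es - 1)" "length es - 1 < length es"
      using t len \<open>es \<noteq> []\<close> by (auto simp: neq_Nil_conv)
    then show ?thesis using trail_nth[OF assms(2), of "length es - 1"] assms(1) t by (metis nth_mem)
  qed
qed

text \<open>Distinct edges will correspond to independent clauses. The inner vertices
  \<open>xs\<close> may repeat, so that the first moment can run over all lists of inner vertices
  and factorises. Since \<open>y\<close> and \<open>z\<close> are among the \<open>L\<close> inner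
  vertices, \<open>L\<close> vertices carry \<open>L + 1\<close> edges.\<close>

definition has_bicycle :: "('e \<Rightarrow> 'v \<Rightarrow> 'v \<Rightarrow> bool) \<Rightarrow> 'e set \<Rightarrow> bool" where
  "has_bicycle link E \<longleftrightarrow> (\<exists>y xs z es. trail link (y # xs @ [z]) es \<and> distinct es \<and>
     set es \<subseteq> E \<and> y \<in> set xs \<and> z \<in> set xs)"

lemma has_bicycleI:
  assumes "trail link (y # xs @ [z]) es" and "distinct es" and "set es \<subseteq> E"
    and "y \<in> set xs" and "z \<in> set xs"
  shows "has_bicycle link E"
  using assms unfolding has_bicycle_def by blast

lemma has_bicycle_mono:
  assumes "has_bicycle link E" and "E \<subseteq> F"
    and "\<And>e x y. e \<in> E \<Longrightarrow> link e x y \<Longrightarrow> link' e x y"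
  shows "has_bicycle link' F"
proof -
  obtain y xs z es where b: "trail link (y # xs @ [z]) es" "distinct es" "set es \<subseteq> E"
      "y \<in> set xs" "z \<in> set xs"
    using assms(1) by (auto simp: has_bicycle_def)
  have "trail link' (y # xs @ [z]) es"
    using b(1) by (rule trail_mono) (use assms(3) b(3) in blast)
  then show ?thesis
    by (rule has_bicycleI) (use b(2-5) \<open>E \<subseteq> F\<close> in simp_all)
qed

lemma trail_extend_to_repetition:
  assumes "finite N" and "inj_on h N" and "D \<inter> h ` N = {}"
    and g: "\<And>x. x \<in> N \<Longrightarrow> g x \<in> N" and h: "\<And>x. x \<in> N \<Longrightarrow> link (h x) x (g x)"
    and "trail link (ps @ xs @ [v]) es" and "distinct es" and "set es \<subseteq> D \<union> h ` set xs"
    and "distinct xs" and "set xs \<subseteq> N" and "v \<in> N"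
  shows "\<exists>xs' v' es'. trail link (ps @ xs @ xs' @ [v']) es' \<and> distinct es' \<and>
           set es' \<subseteq> D \<union> h ` set (xs @ xs') \<and> distinct (xs @ xs') \<and> set (xs @ xs') \<subseteq> N \<and>
           v' \<in> set (xs @ xs')"
  using assms(6-)
proof (induction "card (N - set xs)" arbitrary: xs v es rule: less_induct)
  case less
  show ?case
  proof (cases "v \<in> set xs")
    case True
    then show ?thesis using less.prems by (intro exI[of _ "[]"], intro exI[of _ v], intro exI[of _ es]) auto
  next
    case False
    have hv: "h v \<notin> set es"
    proof
      assume "h v \<in> set es"
      then have "h v \<in> D \<or> h v \<in> h ` set xs"
        using less.prems by blast
      moreover have "h v \<notin> D"
        using assms(3) \<open>v \<in> N\<close> by blast
      ultimately show False
        using False inj_on_image_mem_iff[OF \<open>inj_on h N\<close> \<open>v \<in> N\<close> \<open>set xs \<subseteq> N\<close>] by simp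
    qed
    have "card (N - set (xs @ [v])) < card (N - set xs)"
      using \<open>v \<in> N\<close> False \<open>finite N\<close> by (intro psubset_card_mono) auto
    moreover have "trail link (ps @ (xs @ [v]) @ [g v]) (es @ [h v])"
      using trail_snoc[of link "ps @ xs" v es "h v" "g v"] less.prems h by simp
    moreover have "distinct (es @ [h v])" "set (es @ [h v]) \<subseteq> D \<union> h ` set (xs @ [v])"
      using less.prems hv by auto
    moreover have "distinct (xs @ [v])" "set (xs @ [v]) \<subseteq> N" "g v \<in> N"
      using less.prems False g by auto
    ultimately have "\<exists>xs' v' es'. trail link (ps @ (xs @ [v]) @ xs' @ [v']) es' \<and> distinct es' \<and>
        set es' \<subseteq> D \<union> h ` set ((xs @ [v]) @ xs') \<and> distinct ((xs @ [v]) @ xs') \<and>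
        set ((xs @ [v]) @ xs') \<subseteq> N \<and> v' \<in> set ((xs @ [v]) @ xs')"
      by (rule less.hyps)
    then obtain xs' v' es' where "trail link (ps @ (xs @ [v]) @ xs' @ [v']) es'" "distinct es'"
       "set es' \<subseteq> D \<union> h ` set ((xs @ [v]) @ xs')" "distinct ((xs @ [v]) @ xs')"
       "set ((xs @ [v]) @ xs') \<subseteq> N" "v' \<in> set ((xs @ [v]) @ xs')"
      by (elim exE conjE)
    then show ?thesis
      by (intro exI[of _ "v # xs'"], intro exI[of _ v'], intro exI[of _ es']) simp
  qed
qed

text \<open>
  Follow \<open>g\<close> from \<open>u\<close> until a vertex repeats, turn the trail around, cross the new edge \<open>e\<close>
  and follow \<open>g\<close> from \<open>v\<close> until a vertex repeats.
\<close>

lemma has_bicycle_functional: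
  assumes sym: "\<And>e x y. link e x y \<Longrightarrow> link e y x"
    and "finite N" and "inj_on h N" and "e \<notin> h ` N"
    and g: "\<And>x. x \<in> N \<Longrightarrow> g x \<in> N" and h: "\<And>x. x \<in> N \<Longrightarrow> link (h x) x (g x)"
    and "link e u v" and "u \<in> N" and "v \<in> N"
  shows "has_bicycle link (insert e (h ` N))"
proof -
  \<comment> \<open>First half: empty prefix, no foreign edges, and the step from \<open>u\<close>
    to \<open>g u\<close> already taken.\<close>
  have "\<exists>xs y es. trail link ([] @ [u] @ xs @ [y]) es \<and> distinct es \<and>
      set es \<subseteq> {} \<union> h ` set ([u] @ xs) \<and> distinct ([u] @ xs) \<and> set ([u] @ xs) \<subseteq> N \<and>
      y \<in> set ([u] @ xs)"
    by (rule trail_extend_to_repetition[where g = g and v = "g u" and es = "[h u]"])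
      (use assms in simp_all)
  then obtain xs y es where 1: "trail link (u # xs @ [y]) es" "distinct es"
      "set es \<subseteq> h ` set (u # xs)" "distinct (u # xs)" "set (u # xs) \<subseteq> N" "y \<in> set (u # xs)"
    by (elim exE conjE) simp
  have D: "{e} \<inter> h ` N = {}" using \<open>e \<notin> h ` N\<close> by simp
  have "trail link (y # rev xs @ [u]) (rev es)"
    using trail_rev[OF 1(1) sym] by simp
  then have t: "trail link ([y] @ (rev xs @ [u]) @ [v]) (rev es @ [e])"
    using trail_snoc[of link "y # rev xs" u] \<open>link e u v\<close> by simp
  have es: "distinct (rev es @ [e])" "set (rev es @ [e]) \<subseteq> {e} \<union> h ` set (rev xs @ [u])"
    using 1 \<open>e \<notin> h ` N\<close> by auto
  have xs: "distinct (rev xs @ [u])" "set (rev xs @ [u]) \<subseteq> N"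
    using 1 by auto
  \<comment> \<open>Second half: the prefix is the repeated vertex \<open>y\<close>, and
    \<open>e\<close> is the only foreign edge. All vertices of the first half count as visited, so
    the walk stops on meeting one of them and never reuses an edge of the first half.\<close>
  have "\<exists>zs z es'. trail link ([y] @ (rev xs @ [u]) @ zs @ [z]) es' \<and> distinct es' \<and>
      set es' \<subseteq> {e} \<union> h ` set ((rev xs @ [u]) @ zs) \<and> distinct ((rev xs @ [u]) @ zs) \<and>
      set ((rev xs @ [u]) @ zs) \<subseteq> N \<and> z \<in> set ((rev xs @ [u]) @ zs)"
    using \<open>finite N\<close> \<open>inj_on h N\<close> D g h t es xs \<open>v \<in> N\<close>
    by (rule trail_extend_to_repetition)
  then obtain zs z es' where 2: "trail link ([y] @ (rev xs @ [u]) @ zs @ [z]) es'" "distinct es'"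
      "set es' \<subseteq> {e} \<union> h ` set ((rev xs @ [u]) @ zs)" "set ((rev xs @ [u]) @ zs) \<subseteq> N"
      "z \<in> set ((rev xs @ [u]) @ zs)"
    by (elim exE conjE)
  show ?thesis
  proof (rule has_bicycleI)
    show "trail link (y # (rev xs @ [u] @ zs) @ [z]) es'" using 2 by simp
    have "h ` set ((rev xs @ [u]) @ zs) \<subseteq> h ` N" using 2(4) by (rule image_mono)
    then show "set es' \<subseteq> insert e (h ` N)" using 2(3) by blast
    show "y \<in> set (rev xs @ [u] @ zs)" using 1(6) by auto
    show "z \<in> set (rev xs @ [u] @ zs)" using 2(5) by simp
  qed (rule 2(2))
qed

text \<open>Edges are added one at a time. If some injective choice leaves an end of the new edge
  free, the choice extends. Otherwise both ends lie in the set \<open>N\<close> of vertices occupied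
  by every injective choice; an exchange argument shows that \<open>N\<close> is closed under
  passing to the other end of the occupying edge, and \<open>has_bicycle_functional\<close>
  applies.\<close>

lemma injective_choice_or_has_bicycle:
  fixes a b :: "'e \<Rightarrow> 'v"
  assumes "finite E"
  shows "(\<exists>f. inj_on f E \<and> (\<forall>e\<in>E. f e \<in> {a e, b e})) \<or>
    has_bicycle (\<lambda>e x y. {x, y} = {a e, b e}) E"
  using assms
proof (induction E rule: finite_induct)
  case empty
  then show ?case by simp
next
  case (insert e E)
  define choice where "choice f \<longleftrightarrow> inj_on f E \<and> (\<forall>e\<in>E. f e \<in> {a e, b e})" for f
  define link where "link = (\<lambda>e x y. {x, y} = {a e, b e})"
  show ?case
  proof (cases "has_bicycle link E")
    case True
    then have "has_bicycle link (insert e E)" by (rule has_bicycle_mono) auto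
    then show ?thesis by (simp add: link_def)
  next
    case False
    then obtain f where f: "choice f"
      using insert.IH by (auto simp: choice_def link_def)
    define N where "N = {x. \<forall>f. choice f \<longrightarrow> x \<in> f ` E}"
    show ?thesis
    proof (cases "a e \<in> N \<and> b e \<in> N")
      case False
      then obtain x where x: "x \<in> {a e, b e}" "x \<notin> N"
        by blast
      then obtain f' where f': "choice f'" "x \<notin> f' ` E"
        by (auto simp: N_def)
      then have "inj_on (f'(e := x)) (insert e E)"
        using insert.hyps by (subst inj_on_insert) (auto simp: choice_def inj_on_def)
      moreover have "\<forall>e'\<in>insert e E. (f'(e := x)) e' \<in> {a e', b e'}"
        using f' x by (simp add: choice_def)
      ultimately show ?thesis by blast
    next
      case True
      \<comment> \<open>\<open>h x\<close> is the edge that occupies \<open>x\<close> under the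
        fixed choice \<open>f\<close>, and \<open>g x\<close> is its other end, which is
        \<open>x\<close> itself for a loop.\<close>
      define h where "h = inv_into E f"
      define g where "g x = (if a (h x) = x then b (h x) else a (h x))" for x
      have N: "N \<subseteq> f ` E"
        using f by (auto simp: N_def)
      have hE: "h x \<in> E" "f (h x) = x" if "x \<in> N" for x
        using that N by (auto simp: h_def inv_into_into f_inv_into_f)
      have ends: "{x, g x} = {a (h x), b (h x)}" if "x \<in> N" for x
        using hE[OF that] f unfolding choice_def g_def by (metis doubleton_eq_iff insertE singletonD)
      \<comment> \<open>Exchange: a choice that misses \<open>g x\<close> must send the edge
        \<open>h x\<close> to \<open>x\<close>. Moving that edge to \<open>g x\<close> gives another
        injective choice, and this one misses \<open>x\<close>, contradicting
        \<open>x \<in> N\<close>.\<close>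
      have gN: "g x \<in> N" if x: "x \<in> N" for x
      proof (rule ccontr)
        assume "g x \<notin> N"
        then obtain f' where f': "choice f'" "g x \<notin> f' ` E"
          by (auto simp: N_def)
        have neq: "g x \<noteq> x" using \<open>g x \<notin> N\<close> x by metis
        have "f' (h x) \<in> {x, g x}"
          using f' hE[OF x] ends[OF x] by (simp add: choice_def)
        then have f'x: "f' (h x) = x"
          using f' hE[OF x] by (metis imageI insertE singletonD)
        have "g x \<in> {a (h x), b (h x)}"
          using ends[OF x] by blast
        then have "choice (f'(h x := g x))"
          using f' by (simp add: choice_def inj_on_fun_updI)
        moreover have "x \<notin> (f'(h x := g x)) ` E"
        proof
          assume "x \<in> (f'(h x := g x)) ` E"
          then obtain e' where e': "e' \<in> E" "x = (f'(h x := g x)) e'"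
            by (rule imageE)
          with neq have "e' \<noteq> h x" "f' e' = f' (h x)"
            using f'x by (auto split: if_splits)
          then show False
            using f'(1) e'(1) hE(1)[OF x] by (auto simp: choice_def dest: inj_onD)
        qed
        ultimately show False using x unfolding N_def by blast
      qed
      have "has_bicycle link (insert e (h ` N))"
      proof (rule has_bicycle_functional[where g = g and u = "a e" and v = "b e"])
        show "finite N" using N insert.hyps by (meson finite_imageI finite_subset)
        show "inj_on h N" using hE(2) by (rule inj_on_inverseI)
        show "e \<notin> h ` N" using hE insert.hyps by auto
        show "link (h x) x (g x)" if "x \<in> N" for x
          using ends[OF that] by (simp add: link_def)
        show "link e' y x" if "link e' x y" for e' x y
          using that by (simp add: link_def insert_commute)
      qed (use True gN in \<open>simp_all add: link_def\<close>)
      then have "has_bicycle link (insert e E)"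
        by (rule has_bicycle_mono) (use hE in auto)
      then show ?thesis by (simp add: link_def)
    qed
  qed
qed

subsection \<open>Independent repetitions\<close>

lemma emeasure_replicate_pmf_nth:
  "emeasure (replicate_pmf m q) {xs. \<forall>i<m. xs ! i \<in> A i} = (\<Prod>i<m. emeasure q (A i))"
proof (induction m arbitrary: A)
  case 0
  then show ?case by simp
next
  case (Suc m)
  have "emeasure (replicate_pmf (Suc m) q) {xs. \<forall>i<Suc m. xs ! i \<in> A i} =
      (\<integral>\<^sup>+x. \<integral>\<^sup>+xs. indicator {xs. \<forall>i<Suc m. xs ! i \<in> A i} (x # xs) \<partial>replicate_pmf m q \<partial>q)"
    by simp
  also have "\<dots> = (\<integral>\<^sup>+x. indicator (A 0) x *
      emeasure (replicate_pmf m q) {xs. \<forall>i<m. xs ! i \<in> A (Suc i)} \<partial>q)"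
    by (intro nn_integral_cong, subst nn_integral_indicator[symmetric], simp,
        subst nn_integral_cmult[symmetric], simp)
      (intro nn_integral_cong, auto simp: indicator_def All_less_Suc2 nth_Cons' split: if_splits)
  also have "\<dots> = emeasure q (A 0) * (\<Prod>i<m. emeasure q (A (Suc i)))"
    by (simp add: Suc.IH nn_integral_multc)
  finally show ?case by (simp only: prod.lessThan_Suc_shift)
qed

lemma prob_replicate_pmf_nth:
  "measure_pmf.prob (replicate_pmf m q) {xs. \<forall>i<m. xs ! i \<in> A i} = (\<Prod>i<m. measure_pmf.prob q (A i))"
proof -
  have "ennreal (measure_pmf.prob (replicate_pmf m q) {xs. \<forall>i<m. xs ! i \<in> A i}) =
      ennreal (\<Prod>i<m. measure_pmf.prob q (A i))"
    using emeasure_replicate_pmf_nth[of m q A]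
    by (simp add: measure_pmf.emeasure_eq_measure prod_ennreal)
  then show ?thesis by (simp add: prod_nonneg)
qed

lemma prob_replicate_pmf_nth_eq:
  assumes "i < m"
  shows "measure_pmf.prob (replicate_pmf m q) {xs. xs ! i \<in> B} = measure_pmf.prob q B"
proof -
  have "{xs. xs ! i \<in> B} = {xs. \<forall>j<m. xs ! j \<in> (if j = i then B else UNIV)}"
    using assms by auto
  then show ?thesis
    using assms by (simp only: prob_replicate_pmf_nth)
      (simp add: if_distrib[of "measure_pmf.prob q"] prod.delta' cong: if_cong)
qed

text \<open>Birthday bound: a new entry meets one of \<open>k\<close> others with probability at
  most \<open>k * \<rho>\<close>, and \<open>k + k^2 \<le> (k + 1)^2\<close>.\<close>

lemma prob_replicate_pmf_distinct:
  assumes "\<And>x. pmf q x \<le> \<rho>"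
  shows "measure_pmf.prob (replicate_pmf k q) {xs. \<not> distinct xs} \<le> real (k ^ 2) * \<rho>"
proof (induction k)
  case 0
  then show ?case by simp
next
  case (Suc k)
  have \<rho>: "0 \<le> \<rho>" using assms[of undefined] pmf_nonneg[of q undefined] by linarith
  have mem: "measure_pmf.prob (replicate_pmf k q) {xs. x \<in> set xs} \<le> real k * \<rho>" for x
  proof -
    have "measure_pmf.prob (replicate_pmf k q) {xs. x \<in> set xs} =
        measure_pmf.prob (replicate_pmf k q) (\<Union>i<k. {xs. xs ! i \<in> {x}})"
      by (intro measure_pmf.finite_measure_eq_AE)
        (auto simp: AE_measure_pmf_iff set_replicate_pmf in_set_conv_nth)
    also have "\<dots> \<le> (\<Sum>i<k. measure_pmf.prob (replicate_pmf k q) {xs. xs ! i \<in> {x}})"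
      by (intro measure_pmf.finite_measure_subadditive_finite) auto
    also have "\<dots> = real k * pmf q x"
      using prob_replicate_pmf_nth_eq[of _ k q "{x}"] by (simp add: pmf.rep_eq)
    finally show ?thesis
      using mult_left_mono[OF assms[of x], of "real k"] by simp
  qed
  have split: "emeasure (replicate_pmf k q) {xs. \<not> distinct (x # xs)} \<le>
      ennreal (real k * \<rho> + real (k ^ 2) * \<rho>)" for x
  proof -
    have "{xs. \<not> distinct (x # xs)} = {xs. x \<in> set xs} \<union> {xs. \<not> distinct xs}"
      by auto
    then have "measure_pmf.prob (replicate_pmf k q) {xs. \<not> distinct (x # xs)} \<le>
        measure_pmf.prob (replicate_pmf k q) {xs. x \<in> set xs} +
        measure_pmf.prob (replicate_pmf k q) {xs. \<not> distinct xs}"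
      by (simp only: measure_Un_le sets_measure_pmf UNIV_I)
    also have "\<dots> \<le> real k * \<rho> + real (k ^ 2) * \<rho>"
      using mem[of x] Suc.IH by linarith
    finally show ?thesis by (simp add: measure_pmf.emeasure_eq_measure ennreal_leI)
  qed
  have "emeasure (replicate_pmf (Suc k) q) {xs. \<not> distinct xs} =
      (\<integral>\<^sup>+x. emeasure (replicate_pmf k q) {xs. \<not> distinct (x # xs)} \<partial>q)"
    by (simp, intro nn_integral_cong, subst nn_integral_indicator[symmetric], simp)
      (intro nn_integral_cong, simp add: indicator_def)
  also have "\<dots> \<le> (\<integral>\<^sup>+x. ennreal (real k * \<rho> + real (k ^ 2) * \<rho>) \<partial>q)"
    by (intro nn_integral_mono split)
  also have "\<dots> = ennreal (real k * \<rho> + real (k ^ 2) * \<rho>)"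
    by simp
  also have "\<dots> \<le> ennreal (real ((Suc k) ^ 2) * \<rho>)"
    using \<rho> by (intro ennreal_leI) (simp add: power2_eq_square algebra_simps)
  finally show ?case
    using \<rho> by (simp add: measure_pmf.emeasure_eq_measure)
qed

lemma prob_cond_pmf:
  assumes "set_pmf q \<inter> S \<noteq> {}"
  shows "measure_pmf.prob (cond_pmf q S) A = measure_pmf.prob q (S \<inter> A) / measure_pmf.prob q S"
  using assms
  by (simp add: cond_pmf.rep_eq measure_uniform_measure measure_pmf.emeasure_eq_measure
      measure_measure_pmf_not_zero)

subsection \<open>The first moment of bicycles\<close>

lemma sum_prod_list_lists:
  fixes f :: "'a \<Rightarrow> 'b::comm_semiring_1"
  assumes "finite U"
  shows "(\<Sum>xs | set xs \<subseteq> U \<and> length xs = L. \<Prod>x\<leftarrow>xs. f x) = (\<Sum>x\<in>U. f x) ^ L"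
proof (induction L)
  case 0
  have "{xs. set xs \<subseteq> U \<and> length xs = 0} = {[]}" by auto
  then show ?case by simp
next
  case (Suc L)
  have "{xs. set xs \<subseteq> U \<and> length xs = Suc L} =
      (\<lambda>(x, xs). x # xs) ` (U \<times> {xs. set xs \<subseteq> U \<and> length xs = L})"
    by (auto simp: length_Suc_conv)
  then have "(\<Sum>xs | set xs \<subseteq> U \<and> length xs = Suc L. \<Prod>x\<leftarrow>xs. f x) =
      (\<Sum>(x, xs)\<in>U \<times> {xs. set xs \<subseteq> U \<and> length xs = L}. f x * (\<Prod>x\<leftarrow>xs. f x))"
    by (simp add: sum.reindex inj_on_def case_prod_unfold)
  also have "\<dots> = (\<Sum>x\<in>U. f x) * (\<Sum>xs | set xs \<subseteq> U \<and> length xs = L. \<Prod>x\<leftarrow>xs. f x)"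
    by (simp add: sum.cartesian_product sum_product)
  finally show ?case by (simp add: Suc.IH)
qed

text \<open>Each inner vertex is an end of two consecutive edges and so contributes a square; the
  two outer vertices contribute one factor each.\<close>

lemma prod_consecutive:
  fixes r :: "'a \<Rightarrow> real"
  shows "(\<Prod>t<Suc (length xs). r ((y # xs @ [z]) ! t) * r ((y # xs @ [z]) ! Suc t)) =
    r y * r z * (\<Prod>x\<leftarrow>xs. (r x)\<^sup>2)"
proof (induction xs arbitrary: y)
  case Nil
  then show ?case by simp
next
  case (Cons x xs)
  show ?case
    by (subst prod.lessThan_Suc_shift) (use Cons.IH[of x] in \<open>simp add: power2_eq_square algebra_simps\<close>)
qed

text \<open>Distinct edges are distinct clauses, hence independent, so the edge probabilities
  multiply. The single factors \<open>r y\<close> and \<open>r z\<close> of the ends are estimated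
  by \<open>\<rho>\<close>, leaving a product over the inner vertices alone.\<close>

lemma prob_replicate_pmf_trail:
  fixes r :: "'v \<Rightarrow> real"
  assumes A: "\<And>x y. x \<in> U \<Longrightarrow> y \<in> U \<Longrightarrow> measure_pmf.prob q (A x y) \<le> K * r x * r y"
    and r: "\<And>x. x \<in> U \<Longrightarrow> 0 \<le> r x \<and> r x \<le> \<rho>" and "0 \<le> K"
    and es: "distinct es" "set es \<subseteq> {..<m}" "length es = Suc (length xs)"
    and vs: "set xs \<subseteq> U" "y \<in> set xs" "z \<in> set xs"
  shows "measure_pmf.prob (replicate_pmf m q) {\<Phi>. trail (\<lambda>i x y. \<Phi> ! i \<in> A x y) (y # xs @ [z]) es} \<le>
    K ^ Suc (length xs) * \<rho>\<^sup>2 * (\<Prod>x\<leftarrow>xs. (r x)\<^sup>2)"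
proof -
  define V where "V = y # xs @ [z]"
  \<comment> \<open>All constraints that the trail puts on clause \<open>i\<close>. As
    \<open>es\<close> is distinct there is at most one, and there is none for \<open>i\<close>
    outside \<open>es\<close>.\<close>
  define B where "B i = {c. \<forall>t<length es. es ! t = i \<longrightarrow> c \<in> A (V ! t) (V ! Suc t)}" for i
  have V: "V ! t \<in> U" if "t \<le> length es" for t
  proof -
    have "t < length V" using that es by (simp add: V_def)
    then have "V ! t \<in> set V" by (rule nth_mem)
    then show ?thesis using vs by (auto simp: V_def)
  qed
  have "measure_pmf.prob (replicate_pmf m q) {\<Phi>. trail (\<lambda>i x y. \<Phi> ! i \<in> A x y) V es} \<le>
      measure_pmf.prob (replicate_pmf m q) {\<Phi>. \<forall>i<m. \<Phi> ! i \<in> B i}"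
    by (intro measure_pmf.finite_measure_mono) (auto simp: B_def intro: trail_nth)
  also have "\<dots> = (\<Prod>i<m. measure_pmf.prob q (B i))"
    by (rule prob_replicate_pmf_nth)
  also have "\<dots> = (\<Prod>i\<in>set es. measure_pmf.prob q (B i))"
  proof (rule prod.mono_neutral_right)
    show "\<forall>i\<in>{..<m} - set es. measure_pmf.prob q (B i) = 1"
    proof
      fix i assume "i \<in> {..<m} - set es"
      then have "B i = UNIV" by (auto simp: B_def)
      then show "measure_pmf.prob q (B i) = 1" by simp
    qed
  qed (use es in auto)
  also have "\<dots> = (\<Prod>t<length es. measure_pmf.prob q (B (es ! t)))"
    by (rule prod.reindex_bij_betw[OF bij_betw_nth[OF es(1) refl refl], symmetric])
  also have "\<dots> \<le> (\<Prod>t<length es. K * (r (V ! t) * r (V ! Suc t)))"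
  proof (intro prod_mono conjI)
    fix t assume "t \<in> {..<length es}"
    then have t: "t < length es" by simp
    have "B (es ! t) = A (V ! t) (V ! Suc t)"
      using t es(1) by (auto simp: B_def nth_eq_iff_index_eq)
    then show "measure_pmf.prob q (B (es ! t)) \<le> K * (r (V ! t) * r (V ! Suc t))"
      using A[of "V ! t" "V ! Suc t"] V[of t] V[of "Suc t"] t by (simp add: mult.assoc)
  qed simp
  also have "\<dots> = K ^ Suc (length xs) * (\<Prod>t<Suc (length xs). r (V ! t) * r (V ! Suc t))"
    by (simp add: prod.distrib es(3) del: prod.lessThan_Suc)
  also have "\<dots> = K ^ Suc (length xs) * (r y * r z * (\<Prod>x\<leftarrow>xs. (r x)\<^sup>2))"
    unfolding V_def by (simp only: prod_consecutive)
  also have "\<dots> \<le> K ^ Suc (length xs) * (\<rho>\<^sup>2 * (\<Prod>x\<leftarrow>xs. (r x)\<^sup>2))"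
  proof (intro mult_left_mono mult_right_mono)
    show "r y * r z \<le> \<rho>\<^sup>2"
      unfolding power2_eq_square using r[of y] r[of z] vs by (intro mult_mono) auto
    show "0 \<le> (\<Prod>x\<leftarrow>xs. (r x)\<^sup>2)"
      by (induction xs) auto
  qed (use \<open>0 \<le> K\<close> in simp)
  finally show ?thesis by (simp add: V_def mult.assoc)
qed

text \<open>Absorbs the number of choices of the two ends into a geometric factor. The inductive
  step needs \<open>(L + 1)^2 \<le> 2 * L^2\<close>, which holds from \<open>L = 3\<close>
  on.\<close>

lemma square_le_two_power: "real (L ^ 2) \<le> 4 * 2 ^ L"
proof (induction L)
  case (Suc L)
  consider "L < 3" | "3 \<le> L" by linarith
  then show ?case
  proof cases
    case 1
    then have "L = 0 \<or> L = 1 \<or> L = 2" by auto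
    then show ?thesis by auto
  next
    case 2
    then have "real 3 * real L \<le> real L * real L"
      by (intro mult_right_mono) auto
    then have "1 + real L * 2 \<le> real L * real L"
      using 2 by linarith
    then have "real (Suc L ^ 2) \<le> 2 * real (L ^ 2)"
      by (simp add: power2_eq_square algebra_simps)
    then show ?thesis using Suc.IH by simp
  qed
qed simp

text \<open>Union bound over the number \<open>L\<close> of inner vertices, the
  \<open>m ^ (L + 1)\<close> edge lists, the inner vertex lists, whose total weight is
  \<open>R ^ L\<close>, and at most \<open>L^2\<close> pairs of ends. The smallness assumption turns
  the sum over \<open>L\<close> into a geometric series.\<close>

lemma prob_replicate_pmf_has_bicycle:
  fixes r :: "'v \<Rightarrow> real"
  assumes "finite U"
    and A: "\<And>x y. x \<in> U \<Longrightarrow> y \<in> U \<Longrightarrow> measure_pmf.prob q (A x y) \<le> K * r x * r y"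
    and r: "\<And>x. x \<in> U \<Longrightarrow> 0 \<le> r x \<and> r x \<le> \<rho>" and "0 \<le> K"
    and small: "4 * real m * K * (\<Sum>x\<in>U. (r x)\<^sup>2) \<le> 1"
  shows "measure_pmf.prob (replicate_pmf m q)
      {\<Phi>. has_bicycle (\<lambda>i x y. \<Phi> ! i \<in> A x y \<and> x \<in> U \<and> y \<in> U) {..<m}} \<le> 8 * real m * K * \<rho>\<^sup>2"
proof -
  define Es where "Es L = {es. set es \<subseteq> {..<m} \<and> length es = Suc L}" for L
  define Xs where "Xs L = {xs. set xs \<subseteq> U \<and> length xs = L}" for L
  define ev where "ev es xs y z = {\<Phi>. distinct es \<and> trail (\<lambda>i x y. \<Phi> ! i \<in> A x y) (y # xs @ [z]) es}"
    for es and xs and y z :: 'v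
  define R where "R = (\<Sum>x\<in>U. (r x)\<^sup>2)"
  have R: "0 \<le> R" by (simp add: R_def sum_nonneg)
  have fin: "finite (Es L)" "finite (Xs L)" for L
    using assms(1) by (simp_all add: Es_def Xs_def finite_lists_length_eq)
  define I where "I L = (SIGMA es:Es L. SIGMA xs:Xs L. set xs \<times> set xs)" for L
  have "{\<Phi>. has_bicycle (\<lambda>i x y. \<Phi> ! i \<in> A x y \<and> x \<in> U \<and> y \<in> U) {..<m}} \<subseteq>
      (\<Union>L<m. \<Union>(es, xs, y, z)\<in>I L. ev es xs y z)"
  proof
    fix \<Phi> assume "\<Phi> \<in> {\<Phi>. has_bicycle (\<lambda>i x y. \<Phi> ! i \<in> A x y \<and> x \<in> U \<and> y \<in> U) {..<m}}"
    then obtain y xs z es where b: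
        "trail (\<lambda>i x y. \<Phi> ! i \<in> A x y \<and> x \<in> U \<and> y \<in> U) (y # xs @ [z]) es"
        "distinct es" "set es \<subseteq> {..<m}" "y \<in> set xs" "z \<in> set xs"
      by (auto simp: has_bicycle_def)
    have len: "length es = Suc (length xs)"
      using trail_length[OF b(1)] by simp
    then have "es \<noteq> []" by auto
    have "set (y # xs @ [z]) \<subseteq> U"
      by (rule trail_set[OF _ b(1) \<open>es \<noteq> []\<close>]) simp
    then have "(es, xs, y, z) \<in> I (length xs)"
      using b len by (auto simp: I_def Es_def Xs_def)
    \<comment> \<open>A bicycle uses one more edge than it has inner vertices, and its edges are
      distinct elements of \<open>{..<m}\<close>; so finitely many \<open>L\<close> suffice.\<close>
    moreover have "length xs < m"
      using len distinct_card[OF b(2)] card_mono[OF _ b(3)] by simp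
    moreover have "trail (\<lambda>i x y. \<Phi> ! i \<in> A x y) (y # xs @ [z]) es"
      using b(1) by (rule trail_mono) simp
    then have "\<Phi> \<in> ev es xs y z" using b by (simp add: ev_def)
    ultimately show "\<Phi> \<in> (\<Union>L<m. \<Union>(es, xs, y, z)\<in>I L. ev es xs y z)"
      by (intro UN_I[of "length xs"] UN_I[of "(es, xs, y, z)"]) simp_all
  qed
  then have "measure_pmf.prob (replicate_pmf m q)
      {\<Phi>. has_bicycle (\<lambda>i x y. \<Phi> ! i \<in> A x y \<and> x \<in> U \<and> y \<in> U) {..<m}} \<le>
      measure_pmf.prob (replicate_pmf m q) (\<Union>L<m. \<Union>(es, xs, y, z)\<in>I L. ev es xs y z)"
    by (intro measure_pmf.finite_measure_mono) auto
  also have "\<dots> \<le> (\<Sum>L<m. measure_pmf.prob (replicate_pmf m q) (\<Union>(es, xs, y, z)\<in>I L. ev es xs y z))"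
    by (intro measure_pmf.finite_measure_subadditive_finite) auto
  also have "\<dots> \<le> (\<Sum>L<m. 4 * real m * K * \<rho>\<^sup>2 * (1 / 2) ^ L)"
  proof (rule sum_mono)
    fix L
    have "measure_pmf.prob (replicate_pmf m q) (\<Union>(es, xs, y, z)\<in>I L. ev es xs y z) \<le>
        (\<Sum>i\<in>I L. measure_pmf.prob (replicate_pmf m q) (case i of (es, xs, y, z) \<Rightarrow> ev es xs y z))"
      using fin by (intro measure_pmf.finite_measure_subadditive_finite) (auto simp: I_def)
    also have "\<dots> \<le> (\<Sum>i\<in>I L. case i of (es, xs, y, z) \<Rightarrow> K ^ Suc L * \<rho>\<^sup>2 * (\<Prod>x\<leftarrow>xs. (r x)\<^sup>2))"
    proof (rule sum_mono, clarify)
      fix es xs y z assume "(es, xs, y, z) \<in> I L"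
      then have i: "set es \<subseteq> {..<m}" "length es = Suc (length xs)" "set xs \<subseteq> U" "length xs = L"
        "y \<in> set xs" "z \<in> set xs"
        by (auto simp: I_def Es_def Xs_def)
      show "measure_pmf.prob (replicate_pmf m q) (ev es xs y z) \<le> K ^ Suc L * \<rho>\<^sup>2 * (\<Prod>x\<leftarrow>xs. (r x)\<^sup>2)"
      proof (cases "distinct es")
        case True
        then show ?thesis
          using prob_replicate_pmf_trail[OF A r \<open>0 \<le> K\<close> True i(1,2,3,5,6)] i(4)
          by (simp add: ev_def)
      next
        case False
        have "0 \<le> (\<Prod>x\<leftarrow>xs. (r x)\<^sup>2)" by (induction xs) auto
        then show ?thesis using False \<open>0 \<le> K\<close> by (simp add: ev_def)
      qed
    qed
    also have "\<dots> = (\<Sum>es\<in>Es L. \<Sum>xs\<in>Xs L. \<Sum>yz\<in>set xs \<times> set xs. K ^ Suc L * \<rho>\<^sup>2 * (\<Prod>x\<leftarrow>xs. (r x)\<^sup>2))"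
      using fin by (simp add: I_def sum.Sigma case_prod_unfold del: sum_constant)
    also have "\<dots> \<le> (\<Sum>es\<in>Es L. \<Sum>xs\<in>Xs L. real (L ^ 2) * (K ^ Suc L * \<rho>\<^sup>2 * (\<Prod>x\<leftarrow>xs. (r x)\<^sup>2)))"
    proof (intro sum_mono)
      fix xs assume "xs \<in> Xs L"
      then have "card (set xs) \<le> L" using card_length[of xs] by (simp add: Xs_def)
      then have "real (card (set xs \<times> set xs)) \<le> real (L ^ 2)"
        by (simp only: card_cartesian_product power2_eq_square of_nat_le_iff mult_le_mono)
      moreover have "0 \<le> K ^ Suc L * \<rho>\<^sup>2 * (\<Prod>x\<leftarrow>xs. (r x)\<^sup>2)"
      proof -
        have "0 \<le> (\<Prod>x\<leftarrow>xs. (r x)\<^sup>2)" by (induction xs) auto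
        then show ?thesis using \<open>0 \<le> K\<close> by simp
      qed
      ultimately show "(\<Sum>yz\<in>set xs \<times> set xs. K ^ Suc L * \<rho>\<^sup>2 * (\<Prod>x\<leftarrow>xs. (r x)\<^sup>2)) \<le>
          real (L ^ 2) * (K ^ Suc L * \<rho>\<^sup>2 * (\<Prod>x\<leftarrow>xs. (r x)\<^sup>2))"
        unfolding sum_constant by (rule mult_right_mono)
    qed
    also have "\<dots> = real m ^ Suc L * (real (L ^ 2) * (K ^ Suc L * \<rho>\<^sup>2 * R ^ L))"
    proof -
      have "card (Es L) = m ^ Suc L"
        by (simp add: Es_def card_lists_length_eq)
      moreover have "(\<Sum>xs\<in>Xs L. \<Prod>x\<leftarrow>xs. (r x)\<^sup>2) = R ^ L"
        unfolding Xs_def R_def by (rule sum_prod_list_lists) fact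
      ultimately show ?thesis
        by (simp add: sum_distrib_left[symmetric])
    qed
    also have "\<dots> \<le> real m ^ Suc L * (4 * 2 ^ L * (K ^ Suc L * \<rho>\<^sup>2 * R ^ L))"
      using square_le_two_power[of L] \<open>0 \<le> K\<close> R by (intro mult_left_mono mult_right_mono) auto
    also have "\<dots> = 4 * real m * K * \<rho>\<^sup>2 * (2 * real m * K * R) ^ L"
      by (simp add: power_mult_distrib)
    \<comment> \<open>The assumption \<open>small\<close> bounds \<open>4 * m * K * R\<close> by 1;
      the ratio has lost a factor 2 to the estimate of \<open>L^2\<close> and is therefore at most
      \<open>1 / 2\<close>.\<close>
    also have "\<dots> \<le> 4 * real m * K * \<rho>\<^sup>2 * (1 / 2) ^ L"
      using small R \<open>0 \<le> K\<close> by (intro mult_left_mono power_mono) (auto simp: R_def)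
    finally show "measure_pmf.prob (replicate_pmf m q) (\<Union>(es, xs, y, z)\<in>I L. ev es xs y z) \<le>
        4 * real m * K * \<rho>\<^sup>2 * (1 / 2) ^ L" .
  qed
  also have "\<dots> = 4 * real m * K * \<rho>\<^sup>2 * (\<Sum>L<m. (1 / 2) ^ L)"
    by (simp add: sum_distrib_left)
  also have "\<dots> \<le> 4 * real m * K * \<rho>\<^sup>2 * 2"
    using \<open>0 \<le> K\<close> by (intro mult_left_mono) (simp_all add: geometric_sum)
  finally show ?thesis by simp
qed

subsection \<open>The edge of a clause\<close>

text \<open>
  Variables are indexed by increasing weight, so the smallest indices are the lightest variables.
\<close>

definition smallest_two :: "nat \<Rightarrow> nat \<Rightarrow> clause set" where
  "smallest_two a b = {C. a \<noteq> b \<and> a \<in> fst ` set C \<and> b \<in> fst ` set C \<and>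
     (\<forall>v\<in>fst ` set C. v = a \<or> v = b \<or> max a b \<le> v)}"

lemma smallest_two_commute: "smallest_two a b = smallest_two b a"
  by (auto simp: smallest_two_def max.commute)

lemma smallest_two_exists:
  assumes "2 \<le> card (fst ` set C)"
  shows "\<exists>a b. C \<in> smallest_two a b"
proof -
  define V where "V = fst ` set C"
  define a where "a = Min V"
  define b where "b = Min (V - {a})"
  have "finite V" "V \<noteq> {}" using assms by (auto simp: V_def)
  then have a: "a \<in> V" "\<forall>v\<in>V. a \<le> v" by (auto simp: a_def)
  have "card (V - {a}) \<noteq> 0"
    using assms a \<open>finite V\<close> by (simp add: V_def[symmetric])
  then have "V - {a} \<noteq> {}" by (metis card.empty)
  then have b: "b \<in> V - {a}" "\<forall>v\<in>V - {a}. b \<le> v"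
    using \<open>finite V\<close> Min_in[of "V - {a}"] Min_le[of "V - {a}"] unfolding b_def by blast+
  have "C \<in> smallest_two a b"
    using a b unfolding smallest_two_def mem_Collect_eq V_def[symmetric] by auto
  then show ?thesis by blast
qed

text \<open>An injective choice gives each clause a variable of its own, which can be set to satisfy
  that clause without conflict. If there is none, the bicycle found for the chosen edges is one for
  \<open>smallest_two\<close>, as that relation is symmetric.\<close>

lemma satisfiable_or_has_bicycle:
  assumes "\<And>C. C \<in> set \<Phi> \<Longrightarrow> 2 \<le> card (fst ` set C) \<and> fst ` set C \<subseteq> U"
  shows "satisfiable \<Phi> \<or>
    has_bicycle (\<lambda>i x y. \<Phi> ! i \<in> smallest_two x y \<and> x \<in> U \<and> y \<in> U) {..<length \<Phi>}"
proof -
  have "\<exists>a b. \<Phi> ! i \<in> smallest_two a b" if "i < length \<Phi>" for i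
    using that assms smallest_two_exists by simp
  then obtain a b where ab: "\<And>i. i < length \<Phi> \<Longrightarrow> \<Phi> ! i \<in> smallest_two (a i) (b i)"
    by metis
  consider f where "inj_on f {..<length \<Phi>}" "\<forall>i\<in>{..<length \<Phi>}. f i \<in> {a i, b i}"
    | "has_bicycle (\<lambda>i x y. {x, y} = {a i, b i}) {..<length \<Phi>}"
    using injective_choice_or_has_bicycle[OF finite_lessThan, of "length \<Phi>" a b]
    by (elim disjE exE conjE)
  then show ?thesis
  proof cases
    case 1
    have "\<exists>s. (f i, s) \<in> set (\<Phi> ! i)" if "i < length \<Phi>" for i
    proof -
      have "a i \<in> fst ` set (\<Phi> ! i)" "b i \<in> fst ` set (\<Phi> ! i)"
        using ab[OF that] by (simp_all add: smallest_two_def)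
      moreover have "f i = a i \<or> f i = b i"
        using 1(2) that by simp
      ultimately have "f i \<in> fst ` set (\<Phi> ! i)"
        by metis
      then obtain l where "l \<in> set (\<Phi> ! i)" "f i = fst l"
        by (rule imageE)
      then show ?thesis by (intro exI[of _ "snd l"]) simp
    qed
    then obtain s where s: "\<And>i. i < length \<Phi> \<Longrightarrow> (f i, s i) \<in> set (\<Phi> ! i)"
      by metis
    \<comment> \<open>Each chosen variable takes the sign it has in the clause that chose it; a
      variable chosen by no clause gets an arbitrary value.\<close>
    define \<alpha> where "\<alpha> v = s (inv_into {..<length \<Phi>} f v)" for v
    have "\<alpha> (f i) = s i" if "i < length \<Phi>" for i
      using that 1(1) by (simp add: \<alpha>_def)
    then have "\<exists>(v, b)\<in>set (\<Phi> ! i). \<alpha> v = b" if "i < length \<Phi>" for i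
      using s[OF that] that by (intro bexI[of _ "(f i, s i)"]) simp_all
    then have "satisfies \<alpha> \<Phi>"
      by (simp add: satisfies_def all_set_conv_all_nth)
    then show ?thesis by (auto simp: satisfiable_def)
  next
    case 2
    have "has_bicycle (\<lambda>i x y. \<Phi> ! i \<in> smallest_two x y \<and> x \<in> U \<and> y \<in> U) {..<length \<Phi>}"
    proof (rule has_bicycle_mono[OF 2 order_refl])
      fix i x y assume i: "i \<in> {..<length \<Phi>}" and "{x, y} = {a i, b i}"
      then have "x = a i \<and> y = b i \<or> x = b i \<and> y = a i"
        by (simp add: doubleton_eq_iff)
      then have "smallest_two x y = smallest_two (a i) (b i)"
        by (elim disjE) (simp_all add: smallest_two_commute)
      then have xy: "\<Phi> ! i \<in> smallest_two x y"
        using ab i by simp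
      then have "x \<in> fst ` set (\<Phi> ! i)" "y \<in> fst ` set (\<Phi> ! i)"
        by (simp_all add: smallest_two_def)
      moreover have "fst ` set (\<Phi> ! i) \<subseteq> U"
        using assms i by simp
      ultimately show "\<Phi> ! i \<in> smallest_two x y \<and> x \<in> U \<and> y \<in> U"
        using xy by blast
    qed
    then show ?thesis ..
  qed
qed

section \<open>The variables of a random clause and of a random formula\<close>

lemma set_clause_vars_pmf:
  assumes "set_pmf (replicate_pmf k p) \<inter> {vs. distinct vs} \<noteq> {}"
  shows "set_pmf (clause_vars_pmf k p) = {vs. length vs = k \<and> distinct vs \<and> set vs \<subseteq> set_pmf p}"
  using set_cond_pmf[OF assms] by (auto simp: clause_vars_pmf_def set_replicate_pmf)

text \<open>The signs are drawn independently of the variables, and both lists have length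
  \<open>k\<close>, so \<open>zip\<close> truncates nothing and projecting recovers the
  variables.\<close>

lemma map_fst_clause_pmf:
  assumes "set_pmf (replicate_pmf k p) \<inter> {vs. distinct vs} \<noteq> {}"
  shows "map_pmf (map fst) (clause_pmf k p) = clause_vars_pmf k p"
proof -
  have "map_pmf (map fst) (clause_pmf k p) =
      clause_vars_pmf k p \<bind> (\<lambda>vs. replicate_pmf k (bernoulli_pmf (1 / 2)) \<bind>
        (\<lambda>bs. return_pmf (map fst (zip vs bs))))"
    by (simp add: clause_pmf_def map_bind_pmf)
  also have "\<dots> = clause_vars_pmf k p \<bind> (\<lambda>vs. replicate_pmf k (bernoulli_pmf (1 / 2)) \<bind>
        (\<lambda>bs. return_pmf vs))"
    by (intro bind_pmf_cong refl) (auto simp: set_clause_vars_pmf[OF assms] set_replicate_pmf)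
  finally show ?thesis by (simp add: bind_return_pmf')
qed

lemma ksat_pmf_support:
  assumes "set_pmf (replicate_pmf k p) \<inter> {vs. distinct vs} \<noteq> {}"
    and "\<Phi> \<in> set_pmf (ksat_pmf k m p)"
  shows "length \<Phi> = m" and "C \<in> set \<Phi> \<Longrightarrow> card (fst ` set C) = k \<and> fst ` set C \<subseteq> set_pmf p"
proof -
  show "length \<Phi> = m" using assms(2) by (simp add: ksat_pmf_def set_replicate_pmf)
  assume "C \<in> set \<Phi>"
  then have "C \<in> set_pmf (clause_pmf k p)"
    using assms(2) by (auto simp: ksat_pmf_def set_replicate_pmf)
  then have "map fst C \<in> set_pmf (clause_vars_pmf k p)"
    unfolding map_fst_clause_pmf[OF assms(1), symmetric] by simp
  then have "length (map fst C) = k" "distinct (map fst C)" "set (map fst C) \<subseteq> set_pmf p"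
    unfolding set_clause_vars_pmf[OF assms(1)] by blast+
  then show "card (fst ` set C) = k \<and> fst ` set C \<subseteq> set_pmf p"
    using distinct_card[of "map fst C"] by simp
qed

text \<open>
  The remaining \<open>k - 2\<close> variables of the clause lie above both \<open>a\<close> and \<open>b\<close>. Splitting their
  probability evenly between \<open>a\<close> and \<open>b\<close> gives a bound of product form, which is what the
  first moment over trails needs.
\<close>

definition pair_weight :: "nat \<Rightarrow> nat pmf \<Rightarrow> nat \<Rightarrow> real" where
  "pair_weight k p x = pmf p x * sqrt (measure_pmf.prob p {x..}) ^ (k - 2)"

lemma pair_weight_nonneg: "0 \<le> pair_weight k p x"
  by (simp add: pair_weight_def)

text \<open>Conditioning on distinctness costs a factor of at most 2, and \<open>k^2\<close> bounds
  the number of positions at which \<open>a\<close> and \<open>b\<close> can stand.\<close>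

lemma prob_clause_smallest_two:
  assumes half: "1 / 2 \<le> measure_pmf.prob (replicate_pmf k p) {vs. distinct vs}"
    and "2 \<le> k"
  shows "measure_pmf.prob (clause_pmf k p) (smallest_two a b) \<le>
    2 * real k ^ 2 * pair_weight k p a * pair_weight k p b"
proof (cases "a = b")
  case True
  then have "smallest_two a b = {}" by (auto simp: smallest_two_def)
  then show ?thesis by (simp add: pair_weight_nonneg)
next
  case False
  let ?D = "{vs :: nat list. distinct vs}"
  let ?P = "measure_pmf.prob (replicate_pmf k p)"
  define T where "T x = measure_pmf.prob p {x..}" for x
  define V where "V = {vs. a \<in> set vs \<and> b \<in> set vs \<and> (\<forall>v\<in>set vs. v = a \<or> v = b \<or> max a b \<le> v)}"
  \<comment> \<open>The constraint on entry \<open>i\<close> when \<open>a\<close> stands at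
    position \<open>s\<close> and \<open>b\<close> at position \<open>t\<close>. Dropping
    distinctness of the other entries makes the constraints independent.\<close>
  define A where "A s t i = (if i = s then {a} else if i = t then {b} else {max a b..})" for s t i :: nat
  define w where "w = pair_weight k p a * pair_weight k p b"
  have fin: "finite {(s, t). s < k \<and> t < k \<and> s \<noteq> t}"
    by (rule finite_subset[of _ "{..<k} \<times> {..<k}"]) auto
  have "?P ?D \<noteq> 0"
    using half by linarith
  then have ne: "set_pmf (replicate_pmf k p) \<inter> ?D \<noteq> {}"
    by (simp add: measure_pmf_zero_iff)
  have "smallest_two a b = map fst -` V"
    using False by (auto simp: smallest_two_def V_def)
  then have "measure_pmf.prob (clause_pmf k p) (smallest_two a b) =
      measure_pmf.prob (clause_vars_pmf k p) V"
    by (simp add: map_fst_clause_pmf[OF ne, symmetric])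
  also have "\<dots> = ?P (?D \<inter> V) / ?P ?D"
    unfolding clause_vars_pmf_def by (rule prob_cond_pmf[OF ne])
  also have "\<dots> \<le> 2 * ?P (?D \<inter> V)"
  proof -
    have "?P (?D \<inter> V) / ?P ?D \<le> ?P (?D \<inter> V) / (1 / 2)"
      by (rule divide_left_mono[OF half]) (use half in simp_all)
    then show ?thesis by simp
  qed
  also have "?P (?D \<inter> V) \<le> ?P (\<Union>(s, t)\<in>{(s, t). s < k \<and> t < k \<and> s \<noteq> t}. {vs. \<forall>i<k. vs ! i \<in> A s t i})"
  proof (rule measure_pmf.finite_measure_mono_AE)
    show "AE vs in measure_pmf (replicate_pmf k p). vs \<in> ?D \<inter> V \<longrightarrow>
        vs \<in> (\<Union>(s, t)\<in>{(s, t). s < k \<and> t < k \<and> s \<noteq> t}. {vs. \<forall>i<k. vs ! i \<in> A s t i})"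
      unfolding AE_measure_pmf_iff
    proof (intro ballI impI)
      fix vs assume "vs \<in> set_pmf (replicate_pmf k p)" and vs: "vs \<in> ?D \<inter> V"
      then have len: "length vs = k" by (simp add: set_replicate_pmf)
      have "a \<in> set vs" "b \<in> set vs"
        using vs by (simp_all add: V_def)
      then obtain s t where st: "s < k" "t < k" "vs ! s = a" "vs ! t = b"
        unfolding in_set_conv_nth len by (elim exE conjE)
      have "vs ! i \<in> A s t i" if "i < k" for i
      proof -
        have "distinct vs" using vs by simp
        then have "vs ! i = a \<longleftrightarrow> i = s" "vs ! i = b \<longleftrightarrow> i = t"
          using nth_eq_iff_index_eq[of vs i] st that len by auto
        moreover have "vs ! i \<in> set vs" using that len by simp
        then have "vs ! i = a \<or> vs ! i = b \<or> max a b \<le> vs ! i"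
          using vs by (simp add: V_def)
        ultimately show ?thesis
          using st by (auto simp: A_def)
      qed
      moreover have "s \<noteq> t" using st False by auto
      ultimately show "vs \<in> (\<Union>(s, t)\<in>{(s, t). s < k \<and> t < k \<and> s \<noteq> t}. {vs. \<forall>i<k. vs ! i \<in> A s t i})"
        using st by (intro UN_I[of "(s, t)"]) simp_all
    qed
  qed simp
  also have "\<dots> \<le> (\<Sum>(s, t)\<in>{(s, t). s < k \<and> t < k \<and> s \<noteq> t}. ?P {vs. \<forall>i<k. vs ! i \<in> A s t i})"
    unfolding case_prod_unfold
    by (rule measure_pmf.finite_measure_subadditive_finite) (use fin in \<open>simp_all add: case_prod_unfold\<close>)
  also have "\<dots> \<le> (\<Sum>(s, t)\<in>{(s, t). s < k \<and> t < k \<and> s \<noteq> t}. w)"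
  proof (rule sum_mono, clarify)
    fix s t assume st: "s < k" "t < k" "s \<noteq> t"
    have "?P {vs. \<forall>i<k. vs ! i \<in> A s t i} = (\<Prod>i<k. measure_pmf.prob p (A s t i))"
      by (rule prob_replicate_pmf_nth)
    also have "{..<k} = insert s (insert t ({..<k} - {s, t}))"
      using st by auto
    also have "(\<Prod>i\<in>\<dots>. measure_pmf.prob p (A s t i)) =
        pmf p a * (pmf p b * (\<Prod>i\<in>{..<k} - {s, t}. measure_pmf.prob p (A s t i)))"
      using st by (simp add: A_def pmf.rep_eq)
    also have "(\<Prod>i\<in>{..<k} - {s, t}. measure_pmf.prob p (A s t i)) = T (max a b) ^ (k - 2)"
      using st by (simp add: A_def T_def card_Diff_subset numeral_2_eq_2)
    also have "pmf p a * (pmf p b * T (max a b) ^ (k - 2)) \<le>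
        pmf p a * (pmf p b * (sqrt (T a) ^ (k - 2) * sqrt (T b) ^ (k - 2)))"
    proof (intro mult_left_mono)
      have T: "T (max a b) \<le> T a" "T (max a b) \<le> T b" "0 \<le> T (max a b)"
        by (auto simp: T_def intro!: measure_pmf.finite_measure_mono)
      \<comment> \<open>The tail at the larger index is at most the geometric mean of the two tails;
        this separates \<open>a\<close> from \<open>b\<close>.\<close>
      have "T (max a b) = sqrt (T (max a b)) * sqrt (T (max a b))"
        using T(3) by simp
      also have "\<dots> \<le> sqrt (T a) * sqrt (T b)"
        using T by (intro mult_mono) auto
      finally have "T (max a b) ^ (k - 2) \<le> (sqrt (T a) * sqrt (T b)) ^ (k - 2)"
        using T(3) by (rule power_mono)
      then show "T (max a b) ^ (k - 2) \<le> sqrt (T a) ^ (k - 2) * sqrt (T b) ^ (k - 2)"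
        by (simp add: power_mult_distrib)
    qed auto
    also have "\<dots> = w"
      by (simp add: w_def pair_weight_def T_def)
    finally show "?P {vs. \<forall>i<k. vs ! i \<in> A s t i} \<le> w" .
  qed
  also have "\<dots> \<le> real k ^ 2 * w"
  proof -
    have "card {(s, t). s < k \<and> t < k \<and> s \<noteq> t} \<le> card ({..<k} \<times> {..<k})"
      by (intro card_mono) auto
    then have "real (card {(s, t). s < k \<and> t < k \<and> s \<noteq> t}) \<le> real k ^ 2"
      by (simp add: power2_eq_square flip: of_nat_mult)
    moreover have "0 \<le> w" by (simp add: w_def pair_weight_nonneg)
    ultimately show ?thesis by (simp add: case_prod_unfold mult_right_mono)
  qed
  finally show ?thesis by (simp add: w_def mult.assoc)
qed

text \<open>The bicycle bound for the edges of the clauses, with \<open>K = 2 * k^2\<close>; hence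
  the constants 8 and 16.\<close>

lemma prob_ksat_satisfiable:
  assumes half: "1 / 2 \<le> measure_pmf.prob (replicate_pmf k p) {vs. distinct vs}"
    and "2 \<le> k" and "finite U" and "set_pmf p \<subseteq> U"
    and \<rho>: "\<And>x. x \<in> U \<Longrightarrow> pair_weight k p x \<le> \<rho>"
    and small: "8 * real m * real k ^ 2 * (\<Sum>x\<in>U. (pair_weight k p x)\<^sup>2) \<le> 1"
  shows "1 - measure_pmf.prob (ksat_pmf k m p) {\<Phi>. satisfiable \<Phi>} \<le> 16 * real m * real k ^ 2 * \<rho>\<^sup>2"
proof -
  let ?P = "measure_pmf.prob (ksat_pmf k m p)"
  have "measure_pmf.prob (replicate_pmf k p) {vs. distinct vs} \<noteq> 0"
    using half by linarith
  then have ne: "set_pmf (replicate_pmf k p) \<inter> {vs. distinct vs} \<noteq> {}"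
    by (simp add: measure_pmf_zero_iff)
  have "1 - ?P {\<Phi>. satisfiable \<Phi>} = ?P {\<Phi>. \<not> satisfiable \<Phi>}"
    using measure_pmf.prob_compl[of "{\<Phi>. satisfiable \<Phi>}" "ksat_pmf k m p"]
    by (simp add: Compl_eq_Diff_UNIV[symmetric] Collect_neg_eq)
  also have "\<dots> \<le> ?P {\<Phi>. has_bicycle (\<lambda>i x y. \<Phi> ! i \<in> smallest_two x y \<and> x \<in> U \<and> y \<in> U) {..<m}}"
  proof (rule measure_pmf.finite_measure_mono_AE)
    show "AE \<Phi> in measure_pmf (ksat_pmf k m p). \<Phi> \<in> {\<Phi>. \<not> satisfiable \<Phi>} \<longrightarrow>
        \<Phi> \<in> {\<Phi>. has_bicycle (\<lambda>i x y. \<Phi> ! i \<in> smallest_two x y \<and> x \<in> U \<and> y \<in> U) {..<m}}"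
      unfolding AE_measure_pmf_iff
    proof (intro ballI impI)
      fix \<Phi> assume \<Phi>: "\<Phi> \<in> set_pmf (ksat_pmf k m p)" and "\<Phi> \<in> {\<Phi>. \<not> satisfiable \<Phi>}"
      moreover have "2 \<le> card (fst ` set C) \<and> fst ` set C \<subseteq> U" if "C \<in> set \<Phi>" for C
        using ksat_pmf_support(2)[OF ne \<Phi> that] \<open>2 \<le> k\<close> \<open>set_pmf p \<subseteq> U\<close> by auto
      ultimately show "\<Phi> \<in> {\<Phi>. has_bicycle (\<lambda>i x y. \<Phi> ! i \<in> smallest_two x y \<and> x \<in> U \<and> y \<in> U) {..<m}}"
        using satisfiable_or_has_bicycle[of \<Phi> U] ksat_pmf_support(1)[OF ne \<Phi>] by simp
    qed
  qed simp
  also have "\<dots> \<le> 8 * real m * (2 * real k ^ 2) * \<rho>\<^sup>2"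
    unfolding ksat_pmf_def
  proof (rule prob_replicate_pmf_has_bicycle[where r = "pair_weight k p"])
    show "measure_pmf.prob (clause_pmf k p) (smallest_two x y) \<le>
        2 * real k ^ 2 * pair_weight k p x * pair_weight k p y" for x y
      by (rule prob_clause_smallest_two[OF half \<open>2 \<le> k\<close>])
    show "4 * real m * (2 * real k ^ 2) * (\<Sum>x\<in>U. (pair_weight k p x)\<^sup>2) \<le> 1"
      using small by simp
  qed (use \<rho> \<open>finite U\<close> in \<open>auto simp: pair_weight_nonneg\<close>)
  finally show ?thesis by simp
qed

subsection \<open>Power-law weights\<close>

text \<open>Comparison with the integral of \<open>y powr (b - 1)\<close>, done by telescoping. The
  mean value theorem bounds each term because the derivative is nonincreasing for
  \<open>b \<le> 1\<close>; at 0 the increment is computed directly.\<close>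

lemma sum_powr_le:
  fixes b :: real
  assumes "0 < b" and "b \<le> 1"
  shows "(\<Sum>y=1..x. real y powr (b - 1)) \<le> real x powr b / b"
proof (induction x)
  case 0
  then show ?case by simp
next
  case (Suc x)
  have step: "b * real (Suc x) powr (b - 1) \<le> real (Suc x) powr b - real x powr b"
  proof (cases "x = 0")
    case True
    then show ?thesis using assms by simp
  next
    case False
    have "\<exists>z>real x. z < real (Suc x) \<and>
        real (Suc x) powr b - real x powr b = (real (Suc x) - real x) * (b * z powr (b - 1))"
      by (rule MVT2) (use False in \<open>auto intro!: has_real_derivative_powr\<close>)
    then obtain z where z: "real x < z" "z < real (Suc x)"
        "real (Suc x) powr b - real x powr b = b * z powr (b - 1)"
      by auto
    have "real (Suc x) powr (b - 1) \<le> z powr (b - 1)"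
      using assms z False by (intro powr_mono2') auto
    then show ?thesis using z assms by simp
  qed
  have "(\<Sum>y=1..Suc x. real y powr (b - 1)) \<le> real x powr b / b + real (Suc x) powr (b - 1)"
    using Suc.IH by simp
  also have "\<dots> \<le> real (Suc x) powr b / b"
  proof -
    have "real (Suc x) powr (b - 1) \<le> (real (Suc x) powr b - real x powr b) / b"
      using step assms by (simp add: pos_le_divide_eq mult.commute)
    then show ?thesis by (simp add: diff_divide_distrib)
  qed
  finally show ?case .
qed

text \<open>Variable \<open>i\<close> has rank \<open>x = n + 1 - i\<close> from the heavy end, so
  at least \<open>x\<close> weights reach \<open>w n i\<close>. The tail bound at this threshold
  gives \<open>w n i \<le> (D * n / x) powr (1 / (\<beta> - 1))\<close>, while the total weight is
  at least linear in \<open>n\<close>.\<close>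

lemma power_law_probability_bound:
  assumes "power_law_weights \<beta> w" and "2 < \<beta>" and "a \<le> 1 - 1 / (\<beta> - 1)"
  shows "\<exists>C>0. \<forall>\<^sub>F n in sequentially. \<forall>i\<in>{1..n}.
    w n i / (\<Sum>j=1..n. w n j) \<le> C * real n powr (- a) * real (Suc n - i) powr (a - 1)"
proof -
  define \<gamma> where "\<gamma> = 1 / (\<beta> - 1)"
  have \<gamma>: "0 < \<gamma>" "\<gamma> \<le> 1 - a" "\<gamma> * (\<beta> - 1) = 1"
    using assms by (auto simp: \<gamma>_def field_simps)
  have ws: "weights n (w n)" for n
    using assms(1) by (simp add: power_law_weights_def)
  have "(\<lambda>n. w n 1) \<in> \<Omega>(\<lambda>n. 1)"
    using assms(1) by (auto simp: power_law_weights_def)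
  then obtain c where c: "0 < c" "\<forall>\<^sub>F n in sequentially. c \<le> \<bar>w n 1\<bar>"
    by (auto elim!: landau_omega.bigE)
  obtain c' D where D: "0 < D" and tail: "\<forall>\<^sub>F n in sequentially. \<forall>x\<in>{w n 1..w n n}.
        c' * x powr (1 - \<beta>) \<le> real (card {i\<in>{1..n}. x \<le> w n i}) / real n \<and>
        real (card {i\<in>{1..n}. x \<le> w n i}) / real n \<le> D * x powr (1 - \<beta>)"
    using assms(1) unfolding power_law_weights_def by blast
  have "\<forall>\<^sub>F n in sequentially. \<forall>i\<in>{1..n}.
    w n i / (\<Sum>j=1..n. w n j) \<le> D powr \<gamma> / c * real n powr (- a) * real (Suc n - i) powr (a - 1)"
    using c(2) tail eventually_ge_at_top[of 1]
  proof eventually_elim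
    case (elim n)
    show ?case
    proof
      fix i assume i: "i \<in> {1..n}"
      have pos: "0 < w n j" if "j \<in> {1..n}" for j
        using ws[of n] that by (simp add: weights_def)
      have mono: "w n j \<le> w n l" if "j \<in> {1..n}" "l \<in> {1..n}" "j \<le> l" for j l
        using ws[of n] that by (simp add: weights_def)
      define x where "x = real (Suc n - i)"
      have x: "1 \<le> x" "x \<le> real n"
        using i by (auto simp: x_def)
      have "c \<le> w n 1"
        using elim(1,3) pos[of 1] by simp
      have "card {i..n} \<le> card {j\<in>{1..n}. w n i \<le> w n j}"
        using i mono by (intro card_mono) auto
      then have "x / real n \<le> real (card {j\<in>{1..n}. w n i \<le> w n j}) / real n"
        by (intro divide_right_mono) (simp_all add: x_def)
      also have "\<dots> \<le> D * w n i powr (1 - \<beta>)"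
        using elim(2) i mono[of 1 i] mono[of i n] by simp
      also have "\<dots> = D / w n i powr (\<beta> - 1)"
        using powr_minus_divide[of "w n i" "\<beta> - 1"] by simp
      finally have "w n i powr (\<beta> - 1) * (x / real n) \<le> D"
        using pos[OF i] by (simp add: pos_le_divide_eq mult.commute)
      then have "w n i powr (\<beta> - 1) \<le> D / (x / real n)"
        by (subst pos_le_divide_eq) (use x in simp_all)
      then have "w n i powr (\<beta> - 1) \<le> D * (real n / x)"
        by simp
      then have "(w n i powr (\<beta> - 1)) powr \<gamma> \<le> (D * (real n / x)) powr \<gamma>"
        using \<gamma> by (intro powr_mono2) auto
      moreover have "(w n i powr (\<beta> - 1)) powr \<gamma> = w n i"
        using pos[OF i] \<gamma>(3) by (simp add: powr_powr mult.commute)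
      moreover have "(D * (real n / x)) powr \<gamma> = D powr \<gamma> * (real n / x) powr \<gamma>"
        by (rule powr_mult; use D x in simp)
      ultimately have "w n i \<le> D powr \<gamma> * (real n / x) powr \<gamma>"
        by simp
      \<comment> \<open>As \<open>n / x \<ge> 1\<close>, the exponent \<open>\<gamma>\<close> may be
        raised to \<open>1 - a\<close>. This lets \<open>a\<close> be chosen freely below the true
        exponent.\<close>
      also have "\<dots> \<le> D powr \<gamma> * (real n / x) powr (1 - a)"
        using x \<gamma> by (intro mult_left_mono powr_mono) auto
      also have "\<dots> = D powr \<gamma> * real n * (real n powr (- a) * x powr (a - 1))"
      proof -
        have "real n powr (1 - a) = real n * real n powr (- a)"
          using powr_add[of "real n" 1 "- a"] x by simp
        moreover have "x powr (a - 1) = 1 / x powr (1 - a)"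
          using powr_minus_divide[of x "1 - a"] by simp
        ultimately show ?thesis
          using x by (simp add: powr_divide)
      qed
      finally have wi: "w n i \<le> D powr \<gamma> * real n * (real n powr (- a) * x powr (a - 1))" .
      \<comment> \<open>The smallest weight is at least \<open>c\<close>, so the normalising sum is
        at least \<open>n * c\<close>.\<close>
      have "(\<Sum>j=1..n. c) \<le> (\<Sum>j=1..n. w n j)"
      proof (rule sum_mono)
        fix j assume "j \<in> {1..n}"
        then show "c \<le> w n j" using mono[of 1 j] \<open>c \<le> w n 1\<close> by simp
      qed
      then have sum_ge: "real n * c \<le> (\<Sum>j=1..n. w n j)"
        by simp
      have nc: "0 < real n * c"
        using c(1) elim(3) by simp
      have "w n i / (\<Sum>j=1..n. w n j) \<le> w n i / (real n * c)"
        using sum_ge less_imp_le[OF pos[OF i]] mult_pos_pos[OF order_less_le_trans[OF nc sum_ge] nc]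
        by (rule divide_left_mono)
      also have "\<dots> \<le> D powr \<gamma> * real n * (real n powr (- a) * x powr (a - 1)) / (real n * c)"
        using wi c(1) by (intro divide_right_mono) auto
      also have "\<dots> = D powr \<gamma> / c * real n powr (- a) * x powr (a - 1)"
        using elim(3) c(1) by simp
      finally show "w n i / (\<Sum>j=1..n. w n j) \<le>
          D powr \<gamma> / c * real n powr (- a) * real (Suc n - i) powr (a - 1)"
        by (simp add: x_def)
    qed
  qed
  then show ?thesis
    using c(1) D by (intro exI[of _ "D powr \<gamma> / c"]) simp
qed

text \<open>With rank \<open>x = n + 1 - i\<close>, summing the point probabilities gives a tail of
  at most \<open>C / a * (x / n) powr a\<close>. Its square root, taken \<open>k - 2\<close> times,
  contributes exponent \<open>a * k / 2 - a\<close>, which combines with the point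
  probability.\<close>

lemma pair_weight_bound:
  fixes p :: "nat pmf" and n k :: nat and a C :: real
  assumes "set_pmf p \<subseteq> {1..n}" and "2 \<le> k" and "0 < a" and "a \<le> 1" and "0 < C"
    and p: "\<And>i. i \<in> {1..n} \<Longrightarrow> pmf p i \<le> C * real n powr (- a) * real (Suc n - i) powr (a - 1)"
    and i: "i \<in> {1..n}"
  shows "pair_weight k p i \<le>
    C * sqrt (C / a) ^ (k - 2) * real n powr (- (a * k / 2)) * real (Suc n - i) powr (a * k / 2 - 1)"
proof -
  define x where "x = real (Suc n - i)"
  have x: "1 \<le> x" "x \<le> real n"
    using i by (auto simp: x_def)
  have n: "1 \<le> n" using i by simp
  have "measure_pmf.prob p {i..} = measure_pmf.prob p {i..n}"
    using assms(1) by (intro measure_pmf.finite_measure_eq_AE) (auto simp: AE_measure_pmf_iff)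
  also have "\<dots> = (\<Sum>j=i..n. pmf p j)"
    by (simp add: measure_measure_pmf_finite)
  also have "\<dots> \<le> (\<Sum>j=i..n. C * real n powr (- a) * real (Suc n - j) powr (a - 1))"
    using i p by (intro sum_mono) auto
  also have "\<dots> = C * real n powr (- a) * (\<Sum>j=i..n. real (Suc n - j) powr (a - 1))"
    by (simp add: sum_distrib_left)
  also have "(\<Sum>j=i..n. real (Suc n - j) powr (a - 1)) = (\<Sum>y=1..Suc n - i. real y powr (a - 1))"
    using i by (intro sum.reindex_bij_witness[of _ "\<lambda>y. Suc n - y" "\<lambda>j. Suc n - j"]) auto
  also have "C * real n powr (- a) * (\<Sum>y=1..Suc n - i. real y powr (a - 1)) \<le>
      C * real n powr (- a) * (x powr a / a)"
    unfolding x_def using assms by (intro mult_left_mono sum_powr_le) auto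
  also have "\<dots> = C / a * (x / n) powr a"
    using x by (simp add: powr_divide powr_minus_divide mult_ac)
  finally have "sqrt (measure_pmf.prob p {i..}) \<le> sqrt (C / a * (x / n) powr a)"
    by (rule real_sqrt_le_mono)
  also have "\<dots> = sqrt (C / a) * (x / n) powr (a / 2)"
  proof -
    have "sqrt ((x / n) powr a) = (x / n) powr (a / 2)"
      using x n by (subst powr_half_sqrt[symmetric]) (simp_all add: powr_powr)
    then show ?thesis by (simp only: real_sqrt_mult)
  qed
  finally have "sqrt (measure_pmf.prob p {i..}) ^ (k - 2) \<le> (sqrt (C / a) * (x / n) powr (a / 2)) ^ (k - 2)"
    by (rule power_mono) simp
  also have "\<dots> = sqrt (C / a) ^ (k - 2) * (x / n) powr (a * k / 2 - a)"
  proof -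
    have "((x / n) powr (a / 2)) ^ (k - 2) = (x / n) powr (real (k - 2) * (a / 2))"
      using x n by (subst powr_realpow[symmetric]) (simp_all add: powr_powr mult.commute)
    also have "real (k - 2) * (a / 2) = a * k / 2 - a"
      using \<open>2 \<le> k\<close> by (simp add: of_nat_diff field_simps)
    finally show ?thesis by (simp add: power_mult_distrib)
  qed
  finally have "pair_weight k p i \<le> (C * real n powr (- a) * x powr (a - 1)) *
      (sqrt (C / a) ^ (k - 2) * (x / n) powr (a * k / 2 - a))"
    unfolding pair_weight_def using p[OF i] assms(3,5) by (intro mult_mono) (simp_all add: x_def)
  also have "\<dots> = C * sqrt (C / a) ^ (k - 2) *
      (real n powr (- a) * real n powr (a - a * k / 2)) * (x powr (a - 1) * x powr (a * k / 2 - a))"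
  proof -
    have "(x / n) powr (a * k / 2 - a) = x powr (a * k / 2 - a) * real n powr (a - a * k / 2)"
      using x powr_minus_divide[of "real n" "a * k / 2 - a"] by (simp add: powr_divide)
    then show ?thesis by (simp only: mult_ac)
  qed
  also have "\<dots> = C * sqrt (C / a) ^ (k - 2) * real n powr (- (a * k / 2)) * x powr (a * k / 2 - 1)"
    by (simp only: powr_add[symmetric]) simp
  finally show ?thesis by (simp add: x_def)
qed

text \<open>
  With \<open>a = (1 + \<eta>) / k\<close> the pair weight of the \<open>y\<close>-th heaviest variable is at most
  \<open>D * n powr (- (1 + \<eta>) / 2) * y powr ((\<eta> - 1) / 2)\<close>, so the squares sum to \<open>O(1 / n)\<close>.
\<close>

lemma prob_ksat_satisfiable_power_law:
  fixes p :: "nat pmf" and n k m :: nat and a C \<eta> :: real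
  assumes "set_pmf p \<subseteq> {1..n}" and "2 \<le> k" and "0 < \<eta>" and "\<eta> < 1" and "0 < C"
    and a: "a = (1 + \<eta>) / k"
    and p: "\<And>i. i \<in> {1..n} \<Longrightarrow> pmf p i \<le> C * real n powr (- a) * real (Suc n - i) powr (a - 1)"
    and D: "D = C * sqrt (C / a) ^ (k - 2)"
    and n: "1 \<le> n" "2 * real k ^ 2 * C * real n powr (- a) \<le> 1"
    and m: "8 * real m * real k ^ 2 * D\<^sup>2 \<le> \<eta> * real n"
  shows "1 - measure_pmf.prob (ksat_pmf k m p) {\<Phi>. satisfiable \<Phi>} \<le> 2 * \<eta> * real n powr (- \<eta>)"
proof -
  have a01: "0 < a" "a \<le> 1"
    using assms by (auto simp: a field_simps)
  have ak: "a * k = 1 + \<eta>"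
    using \<open>2 \<le> k\<close> by (simp add: a)
  have le_one: "z powr e \<le> 1" if "1 \<le> z" "e \<le> 0" for z e :: real
    using powr_mono[of e 0 z] that by simp
  have n_powr: "real n powr (- (1 + \<eta>)) = 1 / (real n * real n powr \<eta>)"
    "real n powr (- \<eta>) = 1 / real n powr \<eta>"
    using n powr_minus_divide[of "real n" "1 + \<eta>"] powr_add[of "real n" 1 \<eta>]
    by (simp_all add: powr_minus_divide)
  have "0 \<le> D" using \<open>0 < C\<close> a01 by (simp add: D)
  have r: "pair_weight k p i \<le> D * real n powr (- ((1 + \<eta>) / 2)) * real (Suc n - i) powr ((\<eta> - 1) / 2)"
    if "i \<in> {1..n}" for i
  proof -
    have "(1 + \<eta>) / 2 - 1 = (\<eta> - 1) / 2" by (simp add: field_simps)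
    then show ?thesis
      using pair_weight_bound[OF assms(1,2) a01 \<open>0 < C\<close> p that] by (simp add: ak D)
  qed
  have "1 - measure_pmf.prob (ksat_pmf k m p) {\<Phi>. satisfiable \<Phi>} \<le>
      16 * real m * real k ^ 2 * (D * real n powr (- ((1 + \<eta>) / 2)))\<^sup>2"
  proof (rule prob_ksat_satisfiable[where U = "{1..n}"])
    \<comment> \<open>The heaviest variable has rank 1, so every probability is at most
      \<open>C * n powr (- a)\<close>. By the birthday bound and \<open>n(2)\<close>,
      \<open>k\<close> draws then collide with probability at most \<open>1 / 2\<close>.\<close>
    have "pmf p i \<le> C * real n powr (- a)" for i
    proof (cases "i \<in> {1..n}")
      case True
      have "real (Suc n - i) powr (a - 1) \<le> 1"
        by (rule le_one) (use True a01 in auto)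
      then have "C * real n powr (- a) * real (Suc n - i) powr (a - 1) \<le> C * real n powr (- a) * 1"
        using \<open>0 < C\<close> by (intro mult_left_mono) auto
      then show ?thesis using p[OF True] by linarith
    next
      case False
      then have "pmf p i = 0" using assms(1) by (auto simp: pmf_eq_0_set_pmf)
      then show ?thesis using \<open>0 < C\<close> by simp
    qed
    then have "measure_pmf.prob (replicate_pmf k p) {vs. \<not> distinct vs} \<le>
        real (k ^ 2) * (C * real n powr (- a))"
      by (rule prob_replicate_pmf_distinct)
    also have "\<dots> \<le> 1 / 2"
      using n(2) by simp
    finally show "1 / 2 \<le> measure_pmf.prob (replicate_pmf k p) {vs. distinct vs}"
      using measure_pmf.prob_compl[of "{vs. distinct vs}" "replicate_pmf k p"]
      by (simp add: Compl_eq_Diff_UNIV[symmetric] Collect_neg_eq)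
    show "pair_weight k p i \<le> D * real n powr (- ((1 + \<eta>) / 2))" if "i \<in> {1..n}" for i
    proof -
      have "real (Suc n - i) powr ((\<eta> - 1) / 2) \<le> 1"
        by (rule le_one) (use \<open>\<eta> < 1\<close> that in auto)
      then have "D * real n powr (- ((1 + \<eta>) / 2)) * real (Suc n - i) powr ((\<eta> - 1) / 2) \<le>
          D * real n powr (- ((1 + \<eta>) / 2)) * 1"
        using \<open>0 \<le> D\<close> by (intro mult_left_mono) auto
      then show ?thesis using r[OF that] by linarith
    qed
    have "(\<Sum>i=1..n. (pair_weight k p i)\<^sup>2) \<le>
        (\<Sum>i=1..n. D\<^sup>2 * real n powr (- (1 + \<eta>)) * real (Suc n - i) powr (\<eta> - 1))"
    proof (rule sum_mono)
      fix i assume i: "i \<in> {1..n}"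
      have "(pair_weight k p i)\<^sup>2 \<le>
          (D * real n powr (- ((1 + \<eta>) / 2)) * real (Suc n - i) powr ((\<eta> - 1) / 2))\<^sup>2"
        using r[OF i] by (rule power_mono) (rule pair_weight_nonneg)
      also have "\<dots> = D\<^sup>2 * real n powr (- (1 + \<eta>)) * real (Suc n - i) powr (\<eta> - 1)"
      proof -
        have "(z powr (e / 2))\<^sup>2 = z powr e" for z e :: real
          by (simp add: power2_eq_square powr_add[symmetric])
        then show ?thesis by (simp only: power_mult_distrib minus_divide_left)
      qed
      finally show "(pair_weight k p i)\<^sup>2 \<le>
          D\<^sup>2 * real n powr (- (1 + \<eta>)) * real (Suc n - i) powr (\<eta> - 1)" .
    qed
    also have "\<dots> = D\<^sup>2 * real n powr (- (1 + \<eta>)) * (\<Sum>i=1..n. real (Suc n - i) powr (\<eta> - 1))"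
      by (simp add: sum_distrib_left)
    also have "(\<Sum>i=1..n. real (Suc n - i) powr (\<eta> - 1)) = (\<Sum>y=1..n. real y powr (\<eta> - 1))"
      by (intro sum.reindex_bij_witness[of _ "\<lambda>y. Suc n - y" "\<lambda>j. Suc n - j"]) auto
    \<comment> \<open>As \<open>\<eta> > 0\<close>, the sum of \<open>y powr (\<eta> - 1)\<close> is
      only of order \<open>n powr \<eta>\<close>, which leaves \<open>1 / n\<close> after
      multiplication.\<close>
    also have "D\<^sup>2 * real n powr (- (1 + \<eta>)) * (\<Sum>y=1..n. real y powr (\<eta> - 1)) \<le>
        D\<^sup>2 * real n powr (- (1 + \<eta>)) * (real n powr \<eta> / \<eta>)"
      using assms by (intro mult_left_mono sum_powr_le) auto
    also have "\<dots> = D\<^sup>2 / (\<eta> * real n)"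
      unfolding n_powr using n(1) by simp
    finally have "8 * real m * real k ^ 2 * (\<Sum>i=1..n. (pair_weight k p i)\<^sup>2) \<le>
        8 * real m * real k ^ 2 * (D\<^sup>2 / (\<eta> * real n))"
      by (intro mult_left_mono) auto
    also have "\<dots> \<le> 1"
      using m n \<open>0 < \<eta>\<close> by simp
    finally show "8 * real m * real k ^ 2 * (\<Sum>i=1..n. (pair_weight k p i)\<^sup>2) \<le> 1" .
  qed (use assms in auto)
  \<comment> \<open>Isolates the quantity bounded by assumption \<open>m\<close>, so that one factor
    \<open>n\<close> cancels and \<open>n powr (- \<eta>)\<close> remains.\<close>
  also have "\<dots> = 2 * (8 * real m * real k ^ 2 * D\<^sup>2) * real n powr (- (1 + \<eta>))"
    by (simp add: power_mult_distrib power2_eq_square powr_add[symmetric])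
  also have "\<dots> \<le> 2 * (\<eta> * real n) * real n powr (- (1 + \<eta>))"
    using m by (intro mult_right_mono mult_left_mono) auto
  also have "\<dots> = 2 * \<eta> * real n powr (- \<eta>)"
    unfolding n_powr using n(1) by simp
  finally show ?thesis .
qed

section \<open>Choice of the exponents and of the clause density\<close>

theorem theorem16:
  fixes k :: nat and \<beta> \<epsilon> :: real and w :: "nat \<Rightarrow> nat \<Rightarrow> real"
  assumes "k \<ge> 2"
    and "power_law_weights \<beta> w"
    and "\<epsilon> > 0"
    and "\<beta> \<ge> (2 * real k - 1) / (real k - 1) + \<epsilon>"
  shows "\<exists>c\<^sub>0>0. \<forall>m :: nat \<Rightarrow> nat.
           (\<lambda>n. real (m n)) \<in> \<Theta>(\<lambda>n. real n) \<longrightarrow>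
           (\<forall>\<^sub>F n in sequentially. real (m n) / real n \<le> c\<^sub>0) \<longrightarrow>
           with_high_probability
             (\<lambda>n. measure_pmf.prob (ksat_pmf k (m n) (weight_pmf n (w n))) {\<Phi>. satisfiable \<Phi>})"
proof -
  have k: "1 < real k" using assms(1) by simp
  \<comment> \<open>In this form the threshold says \<open>\<beta> - 1 > k / (k - 1)\<close>, which
    is equivalent to \<open>k * (1 - 1 / (\<beta> - 1)) > 1\<close>, the inequality
    \<open>gap\<close>.\<close>
  have "(2 * real k - 1) / (real k - 1) = 1 + real k / (real k - 1)"
    using k by (simp add: field_simps)
  then have \<beta>: "real k / (real k - 1) < \<beta> - 1"
    using assms(3,4) by linarith
  have "1 < real k / (real k - 1)"
    using k by simp
  then have "2 < \<beta>" using \<beta> by linarith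
  have gap: "1 < k * (1 - 1 / (\<beta> - 1))"
  proof -
    have "real k < (\<beta> - 1) * (real k - 1)"
      using \<beta> k by (simp add: divide_less_eq)
    then show ?thesis
      using \<open>2 < \<beta>\<close> by (simp add: field_simps)
  qed
  \<comment> \<open>The surplus in \<open>gap\<close>, capped at \<open>1 / 2\<close> so that
    \<open>\<eta> < 1\<close>. Then \<open>a * k = 1 + \<eta>\<close>, and \<open>a\<close> stays
    within the exponent that the power law permits.\<close>
  define \<eta> where "\<eta> = min (k * (1 - 1 / (\<beta> - 1)) - 1) (1 / 2)"
  define a where "a = (1 + \<eta>) / k"
  have \<eta>: "0 < \<eta>" "\<eta> < 1"
    using gap by (auto simp: \<eta>_def)
  have "a \<le> 1 - 1 / (\<beta> - 1)"
    using k by (simp add: a_def \<eta>_def divide_le_eq mult.commute)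
  then obtain C where C: "0 < C" "\<forall>\<^sub>F n in sequentially. \<forall>i\<in>{1..n}.
      w n i / (\<Sum>j=1..n. w n j) \<le> C * real n powr (- a) * real (Suc n - i) powr (a - 1)"
    using power_law_probability_bound[OF assms(2) \<open>2 < \<beta>\<close>] by blast
  define D where "D = C * sqrt (C / a) ^ (k - 2)"
  have "0 < a" using \<eta> k by (simp add: a_def)
  then have "0 < D" using C(1) by (simp add: D_def)
  \<comment> \<open>Chosen so that \<open>m / n \<le> c\<^sub>0\<close> is exactly
    \<open>8 * m * k^2 * D^2 \<le> \<eta> * n\<close>.\<close>
  define c\<^sub>0 where "c\<^sub>0 = \<eta> / (8 * real k ^ 2 * D\<^sup>2)"
  have "(\<lambda>n. 2 * real k ^ 2 * C * real n powr (- a)) \<longlonglongrightarrow> 0"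
    using \<open>0 < a\<close> by real_asymp
  then have small: "\<forall>\<^sub>F n in sequentially. 2 * real k ^ 2 * C * real n powr (- a) < 1"
    by (rule order_tendstoD) simp
  show ?thesis
  proof (intro exI[of _ c\<^sub>0] conjI allI impI)
    show "0 < c\<^sub>0" using \<eta> \<open>0 < D\<close> k by (simp add: c\<^sub>0_def)
    fix m :: "nat \<Rightarrow> nat"
    assume m: "\<forall>\<^sub>F n in sequentially. real (m n) / real n \<le> c\<^sub>0"
    let ?P = "\<lambda>n. measure_pmf.prob (ksat_pmf k (m n) (weight_pmf n (w n))) {\<Phi>. satisfiable \<Phi>}"
    have "\<forall>\<^sub>F n in sequentially. 1 - ?P n \<le> 2 * \<eta> * real n powr (- \<eta>)"
      using m small C(2) eventually_ge_at_top[of 1]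
    proof eventually_elim
      case (elim n)
      have pmf: "pmf (weight_pmf n (w n)) i = (if i \<in> {1..n} then w n i / (\<Sum>j=1..n. w n j) else 0)" for i
        using assms(2) elim by (intro pmf_weight_pmf) (auto simp: power_law_weights_def)
      show ?case
      proof (rule prob_ksat_satisfiable_power_law[OF _ assms(1) \<eta> C(1) a_def _ D_def])
        show "set_pmf (weight_pmf n (w n)) \<subseteq> {1..n}"
          unfolding set_pmf_eq by (auto simp: pmf split: if_splits)
        show "pmf (weight_pmf n (w n)) i \<le> C * real n powr (- a) * real (Suc n - i) powr (a - 1)"
          if "i \<in> {1..n}" for i
          using elim(3) that unfolding pmf by simp
        show "8 * real (m n) * real k ^ 2 * D\<^sup>2 \<le> \<eta> * real n"
          using elim(1,4) \<open>0 < D\<close> k by (simp add: c\<^sub>0_def field_simps)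
      qed (use elim in auto)
    qed
    then have "(\<lambda>n. 1 - ?P n) \<in> O(\<lambda>n. real n powr (- \<eta>))"
      by (intro bigoI[of _ "2 * \<eta>"]) (auto elim!: eventually_mono)
    then show "with_high_probability ?P"
      unfolding with_high_probability_def using \<eta>(1) by blast
  qed
qed

end
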